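(* Let a space $X$ admit a continuous transitive action of an $\omega$-narrow topological group. Then $X$ is skeletally Dugundji provided it contains a dense Čech-complete $k$-separable subset, and $X$ is openly Dugundji provided $X$ is Čech-complete and $\sigma$-compact.
   Context: All spaces are Tychonoff (including the underlying spaces of groups). A topological group $G$ is $\omega$-narrow if for every neighborhood $U$ of the neutral element there is a countable set $A\subset G$ with $UA=AU=G$. Actions are left actions $\theta:G\times X\to X$, written $\theta(g,x)=gx$; an action is continuous if $\theta$ is (jointly) continuous, and transitive if for every $x\in X$ the map $\theta^x:G\to X$, $\theta^x(g)=gx$, is surjective. A space is $k$-separable if it contains a dense $\sigma$-compact subset. A continuous map $f:X\to Y$ is skeletal if $\operatorname{Int}\overline{f(U)}\neq\varnothing$ for every nonempty open $U\subset X$ (closure and interior in $Y$). A space $X$ is skeletally (resp., openly) Dugundji if there is a well-ordered inverse system $S=\{X_\alpha,p^\beta_\alpha,\alpha<\beta<\tau\}$, $\tau$ a cardinal (indices are ordinals below $\tau$), with surjective skeletal (resp., open) continuous bonding maps $p^\beta_\alpha:X_\beta\to X_\alpha$, such that: (i) $X_0$ is separable metrizable and every $p^{\alpha+1}_\alpha$ has a metrizable kernel, i.e. there is a separable metrizable space $M_\alpha$ such that $X_{\alpha+1}$ is embedded in $X_\alpha\times M_\alpha$ and $p^{\alpha+1}_\alpha$ is the restriction to $X_{\alpha+1}$ of the projection $X_\alpha\times M_\alpha\to X_\alpha$; (ii) for every (nonzero) limit ordinal $\gamma<\tau$, $X_\gamma$ is a (dense) subspace of $\varprojlim\{X_\alpha,p^\beta_\alpha,\alpha<\beta<\gamma\}$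 (via the natural map induced by the $p^\gamma_\alpha$); (iii) $X$ is embedded in $\varprojlim S$ so that $p_\alpha(X)=X_\alpha$ for each $\alpha$, where $p_\alpha:\varprojlim S\to X_\alpha$ is the limit projection; (iv) for every bounded continuous real-valued function $f$ on $\varprojlim S$ there are $\alpha<\tau$ and a continuous function $g$ on $X_\alpha$ with $f=g\circ p_\alpha$. *)

theory Defs
  imports "HOL-Analysis.Analysis" "HOL-Algebra.Group_Action"
begin

section \<open>Topological spaces\<close>

text \<open>The library's \<^const>\<open>completely_regular_space\<close> includes no separation axiom.\<close>

definition Tychonoff_space :: "'a topology \<Rightarrow> bool"
  where "Tychonoff_space X \<longleftrightarrow> completely_regular_space X \<and> Hausdorff_space X"

definition dense_subset :: "'a topology \<Rightarrow> 'a set \<Rightarrow> bool"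
  where "dense_subset X D \<longleftrightarrow> D \<subseteq> topspace X \<and> X closure_of D = topspace X"

definition sigma_compact_in :: "'a topology \<Rightarrow> 'a set \<Rightarrow> bool"
  where "sigma_compact_in X S \<longleftrightarrow>
    (\<exists>\<K>. countable \<K> \<and> (\<forall>K\<in>\<K>. compactin X K) \<and> S = \<Union>\<K>)"

definition k_separable_space :: "'a topology \<Rightarrow> bool"
  where "k_separable_space X \<longleftrightarrow> (\<exists>S. dense_subset X S \<and> sigma_compact_in X S)"

text \<open>
  The Stone-Cech compactification of a Tychonoff space is the closure of the image of the
  evaluation map into the cube with one factor for each continuous function to the unit interval.
  Functions are taken extensional, so that each function on the space is counted once.
\<close>

definition unit_functions :: "'a topology \<Rightarrow> ('a \<Rightarrow> real) set"
  where "unit_functions X =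
    {f \<in> extensional (topspace X). continuous_map X (top_of_set {0..1}) f}"

definition Stone_Cech_map :: "'a topology \<Rightarrow> 'a \<Rightarrow> ('a \<Rightarrow> real) \<Rightarrow> real"
  where "Stone_Cech_map X x = (\<lambda>f\<in>unit_functions X. f x)"

definition Stone_Cech :: "'a topology \<Rightarrow> (('a \<Rightarrow> real) \<Rightarrow> real) topology"
  where "Stone_Cech X =
    (let cube = product_topology (\<lambda>_. top_of_set {0..1::real}) (unit_functions X)
     in subtopology cube (cube closure_of (Stone_Cech_map X ` topspace X)))"

definition Cech_complete_space :: "'a topology \<Rightarrow> bool"
  where "Cech_complete_space X \<longleftrightarrow>
    Tychonoff_space X \<and> gdelta_in (Stone_Cech X) (Stone_Cech_map X ` topspace X)"

definition skeletal_map :: "'a topology \<Rightarrow> 'b topology \<Rightarrow> ('a \<Rightarrow> 'b) \<Rightarrow> bool"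
  where "skeletal_map X Y f \<longleftrightarrow> continuous_map X Y f \<and>
    (\<forall>U. openin X U \<and> U \<noteq> {} \<longrightarrow> Y interior_of (Y closure_of (f ` U)) \<noteq> {})"

definition continuous_open_map :: "'a topology \<Rightarrow> 'b topology \<Rightarrow> ('a \<Rightarrow> 'b) \<Rightarrow> bool"
  where "continuous_open_map X Y f \<longleftrightarrow> continuous_map X Y f \<and> open_map X Y f"

text \<open>
  A separable metrizable space has at most continuum many points, so every such space
  is homeomorphic to one whose points are real numbers (with a topology unrelated to the
  usual one). Hence nothing is lost by letting \<open>M\<close> range over the type \<^typ>\<open>real topology\<close>.
\<close>

definition metrizable_kernel :: "'a topology \<Rightarrow> 'b topology \<Rightarrow> ('a \<Rightarrow> 'b) \<Rightarrow> bool"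
  where "metrizable_kernel X Y f \<longleftrightarrow>
    (\<exists>(M :: real topology) e.
       metrizable_space M \<and> separable_space M \<and>
       embedding_map X (prod_topology Y M) e \<and>
       (\<forall>x\<in>topspace X. fst (e x) = f x))"


section \<open>Well-ordered inverse systems\<close>

text \<open>
  Ordinals below the cardinal \<open>\<tau>\<close> are the elements of the field of a cardinal order \<open>r\<close>
  (a reflexive well-order of minimal order type). Strict inequality of \<open>\<alpha>\<close> and \<open>\<beta>\<close> is
  \<open>\<alpha> \<in> underS r \<beta>\<close>, and \<open>p \<alpha> \<beta>\<close> is the bonding map from \<open>X \<beta>\<close> to \<open>X \<alpha>\<close>.
\<close>

definition wo_zero :: "'i rel \<Rightarrow> 'i \<Rightarrow> bool"
  where "wo_zero r \<alpha> \<longleftrightarrow> \<alpha> \<in> Field r \<and> underS r \<alpha> = {}"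

definition wo_succ :: "'i rel \<Rightarrow> 'i \<Rightarrow> 'i \<Rightarrow> bool"
  where "wo_succ r \<alpha> \<beta> \<longleftrightarrow>
    \<alpha> \<in> underS r \<beta> \<and> (\<forall>\<gamma>\<in>underS r \<beta>. (\<gamma>, \<alpha>) \<in> r)"

definition wo_limit :: "'i rel \<Rightarrow> 'i \<Rightarrow> bool"
  where "wo_limit r \<gamma> \<longleftrightarrow>
    \<gamma> \<in> Field r \<and> \<not> wo_zero r \<gamma> \<and> (\<nexists>\<alpha>. wo_succ r \<alpha> \<gamma>)"

definition inverse_limit ::
    "'i rel \<Rightarrow> 'i set \<Rightarrow> ('i \<Rightarrow> 'a topology) \<Rightarrow> ('i \<Rightarrow> 'i \<Rightarrow> 'a \<Rightarrow> 'a) \<Rightarrow> ('i \<Rightarrow> 'a) topology"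
  where "inverse_limit r I X p =
    subtopology (product_topology X I)
      {z. \<forall>\<beta>\<in>I. \<forall>\<alpha>\<in>I \<inter> underS r \<beta>. p \<alpha> \<beta> (z \<beta>) = z \<alpha>}"

definition inverse_system ::
    "('a topology \<Rightarrow> 'a topology \<Rightarrow> ('a \<Rightarrow> 'a) \<Rightarrow> bool) \<Rightarrow>
     'i rel \<Rightarrow> ('i \<Rightarrow> 'a topology) \<Rightarrow> ('i \<Rightarrow> 'i \<Rightarrow> 'a \<Rightarrow> 'a) \<Rightarrow> bool"
  where "inverse_system P r X p \<longleftrightarrow>
    Card_order r \<and> Field r \<noteq> {} \<and>
    (\<forall>\<alpha>\<in>Field r. Tychonoff_space (X \<alpha>)) \<and>
    (\<forall>\<beta>\<in>Field r. \<forall>\<alpha>\<in>underS r \<beta>.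
       P (X \<beta>) (X \<alpha>) (p \<alpha> \<beta>) \<and> p \<alpha> \<beta> ` topspace (X \<beta>) = topspace (X \<alpha>)) \<and>
    (\<forall>\<gamma>\<in>Field r. \<forall>\<beta>\<in>underS r \<gamma>. \<forall>\<alpha>\<in>underS r \<beta>.
       \<forall>x\<in>topspace (X \<gamma>). p \<alpha> \<beta> (p \<beta> \<gamma> x) = p \<alpha> \<gamma> x)"

text \<open>
  Both notions of a Dugundji space are instances of one definition, in which \<open>P\<close> is the class
  of bonding maps. The types of the systems are bounded as follows, without loss of generality.
  \<^item> The spaces of a system are images of the given space \<open>Z\<close>, so they may be assumed to have
    their points in the type of points of \<open>Z\<close>.
  \<^item> Identify indices joined by a homeomorphic bonding map. The set of continuous
    functions on \<open>Z\<close> that factor through the \<open>\<alpha>\<close>-th projection grows strictly along the remaining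
    ordinal, so up to one element that ordinal embeds in the set of real functions on \<open>Z\<close>.
    Appending copies of \<open>Z\<close> extends it to a cardinal of size at most the
    successor of the number of real functions on \<open>Z\<close>, which fits in the type of sets of
    such functions.
\<close>

definition Dugundji_space ::
    "('a topology \<Rightarrow> 'a topology \<Rightarrow> ('a \<Rightarrow> 'a) \<Rightarrow> bool) \<Rightarrow> 'a topology \<Rightarrow> bool"
  where "Dugundji_space P Z \<longleftrightarrow>
    (\<exists>(r :: ('a \<Rightarrow> real) set rel) X p.
       inverse_system P r X p \<and>
       (\<forall>\<alpha>. wo_zero r \<alpha> \<longrightarrow> separable_space (X \<alpha>) \<and> metrizable_space (X \<alpha>)) \<and>
       (\<forall>\<alpha> \<beta>. wo_succ r \<alpha> \<beta> \<longrightarrow> metrizable_kernel (X \<beta>) (X \<alpha>) (p \<alpha> \<beta>)) \<and>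
       (\<forall>\<gamma>. wo_limit r \<gamma> \<longrightarrow>
          (let L = inverse_limit r (underS r \<gamma>) X p;
               h = (\<lambda>x. \<lambda>\<alpha>\<in>underS r \<gamma>. p \<alpha> \<gamma> x)
           in embedding_map (X \<gamma>) L h \<and> dense_subset L (h ` topspace (X \<gamma>)))) \<and>
       (let L = inverse_limit r (Field r) X p
        in (\<exists>e. embedding_map Z L e \<and>
              (\<forall>\<alpha>\<in>Field r. (\<lambda>z. e z \<alpha>) ` topspace Z = topspace (X \<alpha>))) \<and>
           (\<forall>f. continuous_map L euclideanreal f \<and> bounded (f ` topspace L) \<longrightarrow>
              (\<exists>\<alpha>\<in>Field r. \<exists>g. continuous_map (X \<alpha>) euclideanreal g \<and>
                 (\<forall>z\<in>topspace L. f z = g (z \<alpha>))))))"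

definition skeletally_Dugundji :: "'a topology \<Rightarrow> bool"
  where "skeletally_Dugundji = Dugundji_space skeletal_map"

definition openly_Dugundji :: "'a topology \<Rightarrow> bool"
  where "openly_Dugundji = Dugundji_space continuous_open_map"


section \<open>Topological groups\<close>

definition topological_group :: "('g, 'm) monoid_scheme \<Rightarrow> 'g topology \<Rightarrow> bool"
  where "topological_group G T \<longleftrightarrow>
    group G \<and> topspace T = carrier G \<and>
    continuous_map (prod_topology T T) T (\<lambda>(g, h). g \<otimes>\<^bsub>G\<^esub> h) \<and>
    continuous_map T T (\<lambda>g. inv\<^bsub>G\<^esub> g)"

definition omega_narrow :: "('g, 'm) monoid_scheme \<Rightarrow> 'g topology \<Rightarrow> bool"
  where "omega_narrow G T \<longleftrightarrow>
    (\<forall>U. U \<subseteq> carrier G \<and> \<one>\<^bsub>G\<^esub> \<in> T interior_of U \<longrightarrow>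
       (\<exists>A. countable A \<and> A \<subseteq> carrier G \<and>
          U <#>\<^bsub>G\<^esub> A = carrier G \<and> A <#>\<^bsub>G\<^esub> U = carrier G))"

end

theory Submission
  imports Defs
begin

text \<open>
  Let \<open>G\<close> be the \<open>\<omega>\<close>-narrow group acting transitively on \<open>X\<close>. A set \<open>F\<close> of continuous real
  functions on \<open>X\<close> yields a quotient of \<open>X\<close>: the initial topology of \<open>F\<close>, with points not
  separated by \<open>F\<close> identified. An increasing well-ordered chain of such sets, taking unions at limits
  and adding countably many functions at each successor, yields an inverse system that satisfies every
  requirement on a Dugundji space except the one on its bonding maps; if the chain separates points
  from closed sets at a proper stage, the system is \<open>X\<close> from there on, and the factorization
  condition becomes trivial. So it is enough to find many countable sets of functions such that every
  union of them gives a skeletal (open) quotient map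
  (\<open>Dugundji_space_by_functions\<close>).

  The sets used are invariant: all translates \<open>f \<circ> \<theta> g\<close> of the members \<open>f\<close> are continuous for the
  initial topology of \<open>F\<close>, so that \<open>G\<close> acts on the quotient by homeomorphisms. If such a
  quotient is not meager in itself, then narrowness gives that the closure of \<open>U x\<close> is a neighbourhood of
  \<open>x\<close> there for every neighbourhood \<open>U\<close> of the identity (\<open>orb_closure_nbhd\<close>): countably many
  translates of \<open>U x\<close> cover the space. This makes the quotient map skeletal.

  Non-meagerness comes from Cech-completeness, expressed by a sequence of open covers such that a family
  with the finite intersection property that is fine for all of them clusters. If every point of a dense
  set has neighbourhoods in the coarser topology that are fine for these covers, the usual Baire argument
  runs in the coarser topology (\<open>nonmeager_coarser_topology\<close>). Over a compact set, one neighbourhood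
  \<open>U\<close> makes all closures of \<open>U x\<close> fine for a given cover, so \<open>\<sigma>\<close>-compactness of a dense set means
  that countably many functions are enough. When these neighbourhoods exist at all points of a
  Cech-complete \<open>X\<close>, the quotient map is moreover closed, and with the density statement this makes it open.

  What remains is to find, for a neighbourhood \<open>U\<close> of the identity, a countable invariant set of functions whose
  initial topology makes every closure of \<open>U x\<close> a neighbourhood of \<open>x\<close>
  (\<open>countable_invariant_family\<close>). A Birkhoff-Kakutani type chain of
  neighbourhoods defines a function on \<open>X\<close> that measures how far a point is from a base point and changes
  little under small group elements. By narrowness, all translates of such a function are uniform
  limits of countably many of them.
\<close>

section \<open>Initial topologies and their Kolmogorov quotients\<close>

definition initial_topology :: "'a set \<Rightarrow> ('a \<Rightarrow> real) set \<Rightarrow> 'a topology"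
  where "initial_topology E F =
    pullback_topology E (\<lambda>x. \<lambda>f\<in>F. f x) (product_topology (\<lambda>_. euclideanreal) F)"

lemma topspace_initial [simp]: "topspace (initial_topology E F) = E"
  by (auto simp: initial_topology_def topspace_pullback_topology)

lemma continuous_map_evaluation:
  "continuous_map (initial_topology E F) (product_topology (\<lambda>_. euclideanreal) F) (\<lambda>x. \<lambda>f\<in>F. f x)"
  using continuous_map_pullback[OF continuous_map_id, of E "\<lambda>x. \<lambda>f\<in>F. f x" "product_topology (\<lambda>_. euclideanreal) F"]
  unfolding initial_topology_def by (simp add: id_comp)

lemma continuous_map_initial_member:
  assumes "f \<in> F" shows "continuous_map (initial_topology E F) euclideanreal f"
proof -
  have "continuous_map (initial_topology E F) euclideanreal ((\<lambda>z. z f) \<circ> (\<lambda>x. \<lambda>f\<in>F. f x))"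
    by (intro continuous_map_compose[OF continuous_map_evaluation] continuous_map_product_projection assms)
  then show ?thesis
    using assms by (simp add: o_def)
qed

lemma continuous_map_into_initial:
  assumes "\<And>x. x \<in> topspace Y \<Longrightarrow> h x \<in> E"
    and "\<And>f. f \<in> F \<Longrightarrow> continuous_map Y euclideanreal (\<lambda>x. f (h x))"
  shows "continuous_map Y (initial_topology E F) h"
  unfolding initial_topology_def
proof (rule continuous_map_pullback')
  show "continuous_map Y (product_topology (\<lambda>_. euclideanreal) F) ((\<lambda>x. \<lambda>f\<in>F. f x) \<circ> h)"
    using assms(2) by (auto simp: continuous_map_componentwise o_def)
qed (use assms(1) in auto)

lemma openin_initial_saturated:
  assumes "openin (initial_topology E F) W" "x \<in> W" "y \<in> E" "\<And>f. f \<in> F \<Longrightarrow> f x = f y"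
  shows "y \<in> W"
proof -
  obtain U where U: "W = (\<lambda>x. \<lambda>f\<in>F. f x) -` U \<inter> E"
    using assms(1) unfolding initial_topology_def openin_pullback_topology by blast
  have "(\<lambda>f\<in>F. f y) = (\<lambda>f\<in>F. f x)"
    by (rule restrict_ext) (simp add: assms(4))
  with U assms(2,3) show ?thesis by simp
qed

lemma completely_regular_space_initial: "completely_regular_space (initial_topology E F)"
  unfolding completely_regular_space_def
proof (intro allI impI, elim conjE)
  let ?P = "product_topology (\<lambda>_::'a \<Rightarrow> real. euclideanreal) F" and ?h = "\<lambda>x. \<lambda>f\<in>F. f x"
  fix S x assume S: "closedin (initial_topology E F) S" and x: "x \<in> topspace (initial_topology E F) - S"
  obtain U where U: "openin ?P U" "E - S = ?h -` U \<inter> E"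
    using S unfolding closedin_def initial_topology_def openin_pullback_topology topspace_initial[unfolded initial_topology_def] by blast
  have "completely_regular_space ?P"
    by (simp add: completely_regular_space_product_topology metrizable_imp_completely_regular_space metrizable_space_euclidean)
  moreover have "closedin ?P (topspace ?P - U)" using U(1) by blast
  moreover have "?h x \<in> topspace ?P - (topspace ?P - U)"
    using U x openin_subset[OF U(1)] by auto
  ultimately obtain g where g: "continuous_map ?P (top_of_set {0..1::real}) g" "g (?h x) = 0"
      "g ` (topspace ?P - U) \<subseteq> {1}"
    unfolding completely_regular_space_def by blast
  have "continuous_map (initial_topology E F) (top_of_set {0..1::real}) (g \<circ> ?h)"
    by (rule continuous_map_compose[OF continuous_map_evaluation g(1)])
  moreover have "(g \<circ> ?h) ` S \<subseteq> {1}"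
  proof -
    have "?h y \<in> topspace ?P - U" if "y \<in> S" for y
      using that U(2) closedin_subset[OF S] by auto
    then have "g (?h y) \<in> {1}" if "y \<in> S" for y
      using g(3) that by blast
    then show ?thesis by auto
  qed
  ultimately show "\<exists>f. continuous_map (initial_topology E F) (top_of_set {0..1::real}) f \<and> f x = 0 \<and> f ` S \<subseteq> {1}"
    using g(2) by fastforce
qed

lemma regular_space_initial: "regular_space (initial_topology E F)"
  by (simp add: completely_regular_imp_regular_space completely_regular_space_initial)

lemma openin_initial_imp:
  assumes "openin (initial_topology (topspace X) F) W" "\<And>f. f \<in> F \<Longrightarrow> continuous_map X euclideanreal f"
  shows "openin X W"
proof -
  have "continuous_map X (initial_topology (topspace X) F) (\<lambda>x. x)"
    by (rule continuous_map_into_initial) (use assms in auto)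
  then have "openin X {x \<in> topspace X. x \<in> W}"
    using assms(1) by (auto simp: continuous_map_def)
  moreover have "{x \<in> topspace X. x \<in> W} = W"
    using openin_subset[OF assms(1)] by auto
  ultimately show ?thesis by simp
qed

lemma openin_initial_mono:
  assumes "openin (initial_topology E F) W" "F \<subseteq> F'"
  shows "openin (initial_topology E F') W"
proof (rule openin_initial_imp)
  show "openin (initial_topology (topspace (initial_topology E F')) F) W"
    using assms(1) by simp
  show "continuous_map (initial_topology E F') euclideanreal f" if "f \<in> F" for f
    using that assms(2) by (intro continuous_map_initial_member) auto
qed

text \<open>
  The spaces of a system on \<open>E\<close> have their points in the type of \<open>E\<close>, so a class of points
  that \<open>F\<close> does not separate is replaced by one of its elements. The chosen element depends
  on the values of the functions in \<open>F\<close> alone, hence is the same for the whole class.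
\<close>
definition representative :: "'a set \<Rightarrow> ('a \<Rightarrow> real) set \<Rightarrow> 'a \<Rightarrow> 'a"
  where "representative E F x = (SOME y. y \<in> E \<and> (\<forall>f\<in>F. f y = f x))"

definition function_quotient :: "'a set \<Rightarrow> ('a \<Rightarrow> real) set \<Rightarrow> 'a topology"
  where "function_quotient E F = subtopology (initial_topology E F) (representative E F ` E)"

lemma representative:
  assumes "x \<in> E"
  shows representative_in: "representative E F x \<in> E"
    and representative_value: "f \<in> F \<Longrightarrow> f (representative E F x) = f x"
  using someI[of "\<lambda>y. y \<in> E \<and> (\<forall>f\<in>F. f y = f x)" x] assms
  unfolding representative_def by auto

lemma representative_eqI:
  assumes "\<And>f. f \<in> F \<Longrightarrow> f x = f y"
  shows "representative E F x = representative E F y"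
  unfolding representative_def by (simp add: assms cong: ball_cong)

lemma representative_representative:
  assumes "x \<in> E" "F \<subseteq> F'"
  shows "representative E F (representative E F' x) = representative E F x"
  by (rule representative_eqI) (use assms representative_value[of x E] in auto)

lemma representative_fixed:
  assumes "x \<in> representative E F ` E" shows "representative E F x = x"
  using assms representative_representative[of _ E F F] by auto

lemma topspace_quotient [simp]: "topspace (function_quotient E F) = representative E F ` E"
  unfolding function_quotient_def using representative_in[of _ E F] by auto

lemma quotient_point_in: "x \<in> representative E F ` E \<Longrightarrow> x \<in> E"
  using representative_in[of _ E F] by auto

lemma continuous_map_quotient_member:
  assumes "f \<in> F" shows "continuous_map (function_quotient E F) euclideanreal f"
  unfolding function_quotient_def
  by (rule continuous_map_from_subtopology) (rule continuous_map_initial_member[OF assms])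

lemma continuous_map_into_quotient:
  assumes "\<And>x. x \<in> topspace Y \<Longrightarrow> h x \<in> representative E F ` E"
    and "\<And>f. f \<in> F \<Longrightarrow> continuous_map Y euclideanreal (\<lambda>x. f (h x))"
  shows "continuous_map Y (function_quotient E F) h"
  unfolding function_quotient_def
proof (rule continuous_map_into_subtopology[OF continuous_map_into_initial])
  show "h x \<in> E" if "x \<in> topspace Y" for x
    using assms(1)[OF that] by (rule quotient_point_in)
qed (use assms in auto)

lemma continuous_map_representative:
  assumes "topspace Y \<subseteq> E" "\<And>f. f \<in> F \<Longrightarrow> continuous_map Y euclideanreal f"
  shows "continuous_map Y (function_quotient E F) (representative E F)"
proof (rule continuous_map_into_quotient)
  fix f assume f: "f \<in> F"
  show "continuous_map Y euclideanreal (\<lambda>x. f (representative E F x))"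
  proof (rule continuous_map_eq[OF assms(2)[OF f]])
    fix x assume "x \<in> topspace Y"
    then have "x \<in> E" using assms(1) by blast
    then show "f x = f (representative E F x)" using f by (simp add: representative_value)
  qed
qed (use assms in auto)

lemma Tychonoff_space_quotient: "Tychonoff_space (function_quotient E F)"
  unfolding Tychonoff_space_def
proof
  show "completely_regular_space (function_quotient E F)"
    unfolding function_quotient_def
    by (intro completely_regular_space_subtopology completely_regular_space_initial)
  show "Hausdorff_space (function_quotient E F)"
    unfolding Hausdorff_space_def
  proof (intro allI impI, elim conjE)
    let ?Q = "function_quotient E F"
    fix x y assume xy: "x \<in> topspace ?Q" "y \<in> topspace ?Q" "x \<noteq> y"
    have "\<exists>f\<in>F. f x \<noteq> f y"
      using representative_eqI[of F x y E] representative_fixed[of x E F] representative_fixed[of y E F] xy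
      by auto
    then obtain f where f: "f \<in> F" "f x \<noteq> f y" by blast
    then obtain U V where UV: "open U" "open V" "f x \<in> U" "f y \<in> V" "U \<inter> V = {}"
      using hausdorff by metis
    have op: "openin ?Q {z \<in> topspace ?Q. f z \<in> W}" if "open W" for W
      using continuous_map_quotient_member[OF f(1), of E] that by (auto simp: continuous_map_def)
    show "\<exists>U V. openin ?Q U \<and> openin ?Q V \<and> x \<in> U \<and> y \<in> V \<and> disjnt U V"
      by (rule exI[of _ "{z \<in> topspace ?Q. f z \<in> U}"], rule exI[of _ "{z \<in> topspace ?Q. f z \<in> V}"])
         (use UV xy op in \<open>auto simp: disjnt_def\<close>)
  qed
qed

text \<open>
  The topology of the quotient is initial for \<open>F\<close>. So a continuous map on it is an embedding as soon as
  every member of \<open>F\<close> can be recovered from the values of the map: this gives injectivity, and it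
  gives continuity of the inverse when composed with the members of \<open>F\<close>.
\<close>
lemma embedding_map_quotient:
  assumes cont: "continuous_map (function_quotient E F) Y e"
    and inv: "\<And>f. f \<in> F \<Longrightarrow> \<exists>\<psi>. continuous_map Y euclideanreal \<psi> \<and>
        (\<forall>x\<in>representative E F ` E. \<psi> (e x) = f x)"
  shows "embedding_map (function_quotient E F) Y e"
proof -
  let ?Q = "function_quotient E F"
  have inj: "inj_on e (topspace ?Q)"
  proof (rule inj_onI)
    fix x y assume xy: "x \<in> topspace ?Q" "y \<in> topspace ?Q" "e x = e y"
    have "f x = f y" if "f \<in> F" for f
      using inv[OF that] xy by (metis topspace_quotient)
    then show "x = y"
      using representative_eqI[of F x y E] representative_fixed[of x E F] representative_fixed[of y E F] xy
      by auto
  qed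
  let ?Y = "subtopology Y (e ` topspace ?Q)" and ?k = "inv_into (topspace ?Q) e"
  have img: "e ` topspace ?Q \<subseteq> topspace Y"
    using cont by (auto simp: continuous_map_def)
  have "continuous_map ?Y ?Q ?k"
  proof (rule continuous_map_into_quotient)
    show "?k y \<in> representative E F ` E" if "y \<in> topspace ?Y" for y
      using that inv_into_into[of y e "topspace ?Q"] by simp
    fix f assume "f \<in> F"
    then obtain \<psi> where \<psi>: "continuous_map Y euclideanreal \<psi>" "\<forall>x\<in>representative E F ` E. \<psi> (e x) = f x"
      using inv by blast
    show "continuous_map ?Y euclideanreal (\<lambda>y. f (?k y))"
    proof (rule continuous_map_eq[OF continuous_map_from_subtopology[OF \<psi>(1)]])
      fix y assume "y \<in> topspace ?Y"
      then obtain x where "x \<in> topspace ?Q" "y = e x" by auto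
      then show "\<psi> y = f (?k y)" using \<psi>(2) inv_into_f_f[OF inj] by auto
    qed
  qed
  moreover have "continuous_map ?Q ?Y e"
    by (rule continuous_map_into_subtopology[OF cont]) auto
  ultimately have "homeomorphic_maps ?Q ?Y e ?k"
    unfolding homeomorphic_maps_def using inj img by (auto simp: f_inv_into_f)
  then show ?thesis
    unfolding embedding_map_def by (rule homeomorphic_maps_imp_map)
qed

text \<open>
  Evaluation at a countable \<open>F\<close> embeds the quotient in the space of real sequences. A sequence is
  determined by the set of pairs \<open>(n, q)\<close> whose rational \<open>q\<close> is below its \<open>n\<close>-th term, and there are
  at most continuum many sets of such pairs; this transports the space to the type of reals,
  where metrizable kernels take their second factor.
\<close>
lemma quotient_coded_in_reals:
  assumes "countable F"
  obtains M :: "real topology" and m where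
    "metrizable_space M" "separable_space M" "homeomorphic_map (function_quotient E F) M m"
proof -
  let ?Q = "function_quotient E F"
  \<comment> \<open>The zero function is added because \<open>F\<close> may be empty.\<close>
  obtain \<phi> :: "nat \<Rightarrow> 'a \<Rightarrow> real" where \<phi>: "range \<phi> = insert (\<lambda>_. 0) F"
    using assms by (metis countable_insert insert_not_empty range_from_nat_into)
  define h where "h x n = \<phi> n x" for x n
  have "embedding_map ?Q euclidean h"
  proof (rule embedding_map_quotient)
    have "continuous_map ?Q euclideanreal (\<phi> n)" for n
      using \<phi> continuous_map_quotient_member[of "\<phi> n" F E] by (metis continuous_map_const insertE rangeI UNIV_I topspace_euclidean)
    then show "continuous_map ?Q euclidean h"
      unfolding euclidean_product_topology[symmetric] h_def by (simp add: continuous_map_componentwise_UNIV)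
    fix f assume "f \<in> F"
    then obtain n where "f = \<phi> n" using \<phi> by blast
    moreover have "continuous_map euclidean euclideanreal (\<lambda>z::nat \<Rightarrow> real. z n)"
      by (simp add: continuous_on_product_coordinates)
    ultimately show "\<exists>\<psi>. continuous_map euclidean euclideanreal \<psi> \<and>
        (\<forall>x\<in>representative E F ` E. \<psi> (h x) = f x)"
      unfolding h_def by blast
  qed
  then have hom: "homeomorphic_map ?Q (top_of_set (h ` topspace ?Q)) h"
    by (simp add: embedding_map_def)
  define H where "H = h ` topspace ?Q"
  have "(UNIV::(nat \<times> rat) set set) \<lesssim> (UNIV::real set)"
  proof -
    have "(UNIV::(nat \<times> rat) set set) \<lesssim> (UNIV::nat set set)"
      unfolding lepoll_def
      by (rule exI[of _ "\<lambda>A. to_nat ` A"]) (simp add: inj_on_def inj_image_eq_iff)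
    then show ?thesis
      using nat_sets_eqpoll_reals lepoll_trans eqpoll_imp_lepoll by blast
  qed
  then obtain c :: "(nat \<times> rat) set \<Rightarrow> real" where c: "inj c"
    unfolding lepoll_def by blast
  define j where "j z = c {(n, q). real_of_rat q < z n}" for z :: "nat \<Rightarrow> real"
  have j: "inj j"
  proof (rule injI)
    fix y z assume "j y = j z"
    then have eq: "{(n, q). real_of_rat q < y n} = {(n, q). real_of_rat q < z n}"
      unfolding j_def using c by (meson injD)
    then have "real_of_rat q < y n \<longleftrightarrow> real_of_rat q < z n" for n q by auto
    then have "\<not> y n < z n" "\<not> z n < y n" for n
      by (metis of_rat_dense order_less_asym order_less_irrefl)+
    then show "y = z" by (meson ext not_less_iff_gr_or_eq)
  qed
  define M where "M = pullback_topology (j ` H) (inv_into UNIV j) (top_of_set H)"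
  have topM: "topspace M = j ` H"
    unfolding M_def topspace_pullback_topology using j by auto
  have "homeomorphic_maps (top_of_set H) M j (inv_into UNIV j)"
    unfolding homeomorphic_maps_def
  proof (intro conjI)
    show "continuous_map (top_of_set H) M j"
      unfolding M_def
    proof (rule continuous_map_pullback')
      have "inv_into UNIV j \<circ> j = id" using j by auto
      then show "continuous_map (top_of_set H) (top_of_set H) (inv_into UNIV j \<circ> j)" by simp
    qed auto
    have "continuous_map M (top_of_set H) (id \<circ> inv_into UNIV j)"
      unfolding M_def by (rule continuous_map_pullback) simp
    then show "continuous_map M (top_of_set H) (inv_into UNIV j)" by simp
  qed (use j topM in auto)
  then have homM: "homeomorphic_map (top_of_set H) M j"
    by (rule homeomorphic_maps_imp_map)
  then have space: "top_of_set H homeomorphic_space M"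
    by (rule homeomorphic_map_imp_homeomorphic_space)
  show ?thesis
  proof
    show "metrizable_space M"
      using homeomorphic_metrizable_space[OF space] metrizable_space_subtopology metrizable_space_euclidean by blast
    have "second_countable (euclidean :: (nat \<Rightarrow> real) topology)"
    proof -
      obtain B :: "(nat \<Rightarrow> real) set set" where "countable B" "topological_basis B"
        using ex_countable_basis by blast
      then show ?thesis
        unfolding second_countable_def topological_basis_iff[OF topological_basis_open[OF \<open>topological_basis B\<close>]]
        using topological_basis_open topological_basisE by (metis open_openin)
    qed
    then have "separable_space (top_of_set H)"
      by (intro second_countable_imp_separable_space second_countable_subtopology)
    then show "separable_space M"
      using homeomorphic_separable_space[OF space] by blast
    show "homeomorphic_map ?Q M (j \<circ> h)"
      using homeomorphic_map_compose[OF hom[folded H_def] homM] .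
  qed
qed

lemma in_closure_of_mono: "x \<in> X closure_of A \<Longrightarrow> A \<subseteq> B \<Longrightarrow> x \<in> X closure_of B"
  using closure_of_mono[of A B X] by blast

lemma in_interior_of_imp: "x \<in> X interior_of A \<Longrightarrow> x \<in> A"
  using interior_of_subset[of X A] by blast

lemma in_closure_of_self: "x \<in> A \<Longrightarrow> A \<subseteq> topspace X \<Longrightarrow> x \<in> X closure_of A"
  using closure_of_subset[of A X] by blast

lemma openin_representative_preimage:
  assumes "\<And>f. f \<in> F \<Longrightarrow> continuous_map X euclideanreal f" "openin (function_quotient (topspace X) F) U"
  shows "openin X {x \<in> topspace X. representative (topspace X) F x \<in> U}"
  by (rule openin_continuous_map_preimage[OF continuous_map_representative assms(2)]) (simp_all add: assms(1))

lemma continuous_map_quotient_quotient: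
  assumes "F \<subseteq> F'"
  shows "continuous_map (function_quotient E F') (function_quotient E F) (representative E F)"
proof (rule continuous_map_representative)
  show "topspace (function_quotient E F') \<subseteq> E" using quotient_point_in[of _ E F'] by auto
  show "continuous_map (function_quotient E F') euclideanreal f" if "f \<in> F" for f
    using that assms by (intro continuous_map_quotient_member) auto
qed

lemma representative_in_open:
  assumes "openin (initial_topology E F) W" "x \<in> W"
  shows "representative E F x \<in> W"
proof -
  have "x \<in> E" using openin_subset[OF assms(1)] assms(2) by auto
  then show ?thesis
    using openin_initial_saturated[OF assms, of "representative E F x"]
    by (simp add: representative_in representative_value)
qed

lemma openin_quotient:
  "openin (initial_topology E F) W \<Longrightarrow> openin (function_quotient E F) (W \<inter> representative E F ` E)"
  unfolding function_quotient_def openin_subtopology by blast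

text \<open>
  Open sets of the quotient by \<open>F\<close> are traces of saturated sets that are open for the initial
  topology, so skeletality can be tested on \<open>X\<close>, for the identity into that topology.
\<close>
lemma skeletal_map_representative:
  assumes cont: "\<And>f. f \<in> F' \<Longrightarrow> continuous_map X euclideanreal f" and sub: "F \<subseteq> F'"
    and somewhere_dense: "\<And>V. openin X V \<Longrightarrow> V \<noteq> {} \<Longrightarrow>
      initial_topology (topspace X) F interior_of (initial_topology (topspace X) F closure_of V) \<noteq> {}"
  shows "skeletal_map (function_quotient (topspace X) F') (function_quotient (topspace X) F)
    (representative (topspace X) F)"
  unfolding skeletal_map_def
proof (intro conjI allI impI, rule continuous_map_quotient_quotient[OF sub], elim conjE)
  let ?E = "topspace X" and ?t = "initial_topology (topspace X) F"
  let ?rep = "representative ?E" and ?Q = "function_quotient ?E"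
  fix U assume U: "openin (?Q F') U" "U \<noteq> {}"
  define V where "V = {x \<in> ?E. ?rep F' x \<in> U}"
  have V: "openin X V" unfolding V_def by (rule openin_representative_preimage[OF cont U(1)])
  obtain y where y: "y \<in> U" using U(2) by blast
  then have "y \<in> ?rep F' ` ?E" using openin_subset[OF U(1)] by auto
  then have "y \<in> V"
    using y representative_fixed[of y ?E F'] quotient_point_in[of y ?E F'] by (simp add: V_def)
  then obtain x where x: "x \<in> ?t interior_of (?t closure_of V)"
    using somewhere_dense[OF V] by blast
  define W where "W = ?t interior_of (?t closure_of V)"
  have W: "openin ?t W" "x \<in> W" using x by (simp_all add: W_def)
  have WV: "z \<in> ?t closure_of V" if "z \<in> W" for z
    using that unfolding W_def by (rule in_interior_of_imp)
  have xE: "x \<in> ?E" using openin_subset[OF W(1)] W(2) by auto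
  have "W \<inter> ?rep F ` ?E \<subseteq> ?Q F closure_of (?rep F ` U)"
  proof
    fix z assume z: "z \<in> W \<inter> ?rep F ` ?E"
    show "z \<in> ?Q F closure_of (?rep F ` U)"
      unfolding in_closure_of[of z]
    proof (intro conjI allI impI, use z in simp, elim conjE)
      fix S assume "z \<in> S" "openin (?Q F) S"
      then obtain S' where S': "openin ?t S'" "S = S' \<inter> ?rep F ` ?E" "z \<in> S'"
        unfolding function_quotient_def openin_subtopology by auto
      have "\<forall>S. z \<in> S \<and> openin ?t S \<longrightarrow> (\<exists>v. v \<in> V \<and> v \<in> S)"
        using WV[of z] z unfolding in_closure_of[of z] by simp
      then obtain v where v: "v \<in> V" "v \<in> S'" using S' by auto
      have vE: "v \<in> ?E" and vU: "?rep F' v \<in> U" using v(1) by (auto simp: V_def)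
      have "?rep F (?rep F' v) = ?rep F v" by (rule representative_representative[OF vE sub])
      moreover have "?rep F v \<in> S" using representative_in_open[OF S'(1) v(2)] S'(2) vE by simp
      ultimately show "\<exists>w. w \<in> ?rep F ` U \<and> w \<in> S" using vU by (metis imageI)
    qed
  qed
  then have "W \<inter> ?rep F ` ?E \<subseteq> ?Q F interior_of (?Q F closure_of (?rep F ` U))"
    by (rule interior_of_maximal) (rule openin_quotient[OF W(1)])
  moreover have "?rep F x \<in> W \<inter> ?rep F ` ?E"
    using representative_in_open[OF W] xE by simp
  ultimately show "?Q F interior_of (?Q F closure_of (?rep F ` U)) \<noteq> {}" by blast
qed

text \<open>
  The last hypothesis makes the saturation of every open \<open>V\<close> a neighbourhood, in the initial topology of
  \<open>F\<close>, of each point of \<open>V\<close>.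
\<close>
lemma open_map_representative:
  assumes cont: "\<And>f. f \<in> F' \<Longrightarrow> continuous_map X euclideanreal f" and sub: "F \<subseteq> F'"
    and saturation: "\<And>V x. openin X V \<Longrightarrow> x \<in> V \<Longrightarrow>
      \<exists>W. openin (initial_topology (topspace X) F) W \<and> x \<in> W \<and> (\<forall>w\<in>W. \<exists>v\<in>V. \<forall>f\<in>F. f v = f w)"
  shows "continuous_open_map (function_quotient (topspace X) F') (function_quotient (topspace X) F)
    (representative (topspace X) F)"
  unfolding continuous_open_map_def open_map_def
proof (intro conjI allI impI, rule continuous_map_quotient_quotient[OF sub])
  let ?E = "topspace X" and ?t = "initial_topology (topspace X) F"
  let ?rep = "representative ?E" and ?Q = "function_quotient ?E"
  fix U assume U: "openin (?Q F') U"
  define V where "V = {x \<in> ?E. ?rep F' x \<in> U}"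
  have V: "openin X V" unfolding V_def by (rule openin_representative_preimage[OF cont U])
  show "openin (?Q F) (?rep F ` U)"
  proof (subst openin_subopen, intro ballI)
    fix y assume "y \<in> ?rep F ` U"
    then obtain u where u: "u \<in> U" "y = ?rep F u" by blast
    then have u': "u \<in> ?rep F' ` ?E" using openin_subset[OF U] by auto
    then have uE: "u \<in> ?E" by (rule quotient_point_in)
    have "u \<in> V" using u(1) uE representative_fixed[OF u'] by (simp add: V_def)
    then obtain W where W: "openin ?t W" "u \<in> W" "\<And>w. w \<in> W \<Longrightarrow> \<exists>v\<in>V. \<forall>f\<in>F. f v = f w"
      using saturation[OF V] by metis
    have "W \<inter> ?rep F ` ?E \<subseteq> ?rep F ` U"
    proof
      fix z assume z: "z \<in> W \<inter> ?rep F ` ?E"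
      then obtain v where v: "v \<in> V" "\<forall>f\<in>F. f v = f z" using W(3) by blast
      then have vE: "v \<in> ?E" and vU: "?rep F' v \<in> U" by (auto simp: V_def)
      have "?rep F (?rep F' v) = ?rep F v" by (rule representative_representative[OF vE sub])
      also have "\<dots> = ?rep F z" by (rule representative_eqI) (use v(2) in simp)
      also have "\<dots> = z" by (rule representative_fixed) (rule IntD2[OF z])
      finally show "z \<in> ?rep F ` U" using vU by (metis imageI)
    qed
    moreover have "y \<in> W \<inter> ?rep F ` ?E"
      using representative_in_open[OF W(1,2)] u(2) uE by simp
    ultimately show "\<exists>S. openin (?Q F) S \<and> y \<in> S \<and> S \<subseteq> ?rep F ` U"
      using openin_quotient[OF W(1)] by (intro exI[of _ "W \<inter> ?rep F ` ?E"]) simp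
  qed
qed

section \<open>Well-ordered systems of function quotients\<close>

text \<open>
  A cardinal order with an element \<open>a\<close> that has room for all of \<open>'b\<close> below it, by Cantor's theorem. A
  system over it can list a family indexed by \<open>'b\<close> before stage \<open>a\<close> and stay constant afterwards.
\<close>
lemma longer_Card_order:
  obtains r :: "'b set rel" and a and \<iota> :: "'b \<Rightarrow> 'b set" where
    "Card_order r" "Field r = UNIV" "inj \<iota>" "\<And>c. \<iota> c \<in> underS r a"
proof -
  let ?r = "card_of (UNIV :: 'b set set)" and ?s = "card_of (UNIV :: 'b set)"
  have "(?s, ?r) \<in> ordLess"
    using card_of_Pow[of "UNIV :: 'b set"] by simp
  then have "\<exists>a\<in>Field ?r. (?s, Restr ?r (underS ?r a)) \<in> ordIso"
    by (rule iffD1[OF ordLess_iff_ordIso_Restr[OF card_of_Well_order card_of_Well_order]])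
  then obtain a where "(?s, Restr ?r (underS ?r a)) \<in> ordIso"
    by (rule bexE)
  then obtain \<iota> where "BNF_Wellorder_Embedding.iso ?s (Restr ?r (underS ?r a)) \<iota>"
    unfolding ordIso_def by auto
  then have bij: "bij_betw \<iota> (UNIV :: 'b set) (Field (Restr ?r (underS ?r a)))"
    unfolding BNF_Wellorder_Embedding.iso_def by (simp add: Field_card_of)
  show thesis
  proof
    show "Card_order ?r" by (rule card_of_Card_order)
    show "Field ?r = UNIV" by (simp add: Field_card_of)
    show "inj \<iota>" using bij by (simp add: bij_betw_def)
    have "Field (Restr ?r (underS ?r a)) \<subseteq> underS ?r a"
      by (auto simp: Field_def)
    then show "\<iota> c \<in> underS ?r a" for c
      using bij by (auto simp: bij_betw_def)
  qed
qed

lemma Well_order_underS_trans: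
  assumes "Well_order r" "\<alpha> \<in> underS r \<beta>" "\<beta> \<in> underS r \<gamma>"
  shows "\<alpha> \<in> underS r \<gamma>"
proof -
  have "trans r" "antisym r"
    using assms(1) by (auto simp: well_order_on_def linear_order_on_def partial_order_on_def preorder_on_def)
  then show ?thesis
    using assms(2,3) unfolding underS_def by (auto dest: transD antisymD)
qed

lemma Well_order_linear:
  assumes "Well_order r" "\<alpha> \<in> Field r" "\<beta> \<in> Field r"
  shows "\<alpha> \<in> underS r \<beta> \<or> \<alpha> = \<beta> \<or> \<beta> \<in> underS r \<alpha>"
  using assms unfolding well_order_on_def linear_order_on_def total_on_def underS_def by auto

lemma underS_succ:
  assumes "Well_order r" "wo_succ r \<alpha> \<beta>"
  shows "underS r \<beta> = insert \<alpha> (underS r \<alpha>)"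
proof (intro equalityI subsetI)
  have \<alpha>: "\<alpha> \<in> underS r \<beta>" using assms(2) by (simp add: wo_succ_def)
  show "\<gamma> \<in> insert \<alpha> (underS r \<alpha>)" if "\<gamma> \<in> underS r \<beta>" for \<gamma>
    using assms(2) that by (auto simp: wo_succ_def underS_def)
  show "\<gamma> \<in> underS r \<beta>" if "\<gamma> \<in> insert \<alpha> (underS r \<alpha>)" for \<gamma>
    using that \<alpha> Well_order_underS_trans[OF assms(1) _ \<alpha>] by blast
qed

lemma wo_limit_between:
  assumes "Well_order r" "wo_limit r \<gamma>" "\<beta> \<in> underS r \<gamma>"
  obtains \<alpha> where "\<alpha> \<in> underS r \<gamma>" "\<beta> \<in> underS r \<alpha>"
proof -
  obtain \<alpha> where \<alpha>: "\<alpha> \<in> underS r \<gamma>" "(\<alpha>, \<beta>) \<notin> r"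
    using assms(2,3) unfolding wo_limit_def wo_succ_def by blast
  have "refl_on (Field r) r"
    using assms(1) by (auto simp: well_order_on_def linear_order_on_def partial_order_on_def preorder_on_def)
  moreover have "\<alpha> \<in> Field r" "\<beta> \<in> Field r"
    using \<alpha>(1) assms(3) by (auto simp: underS_def Field_def)
  ultimately have "\<beta> \<in> underS r \<alpha>"
    using Well_order_linear[OF assms(1), of \<alpha> \<beta>] \<alpha>(2) by (auto simp: underS_def refl_on_def)
  with \<alpha>(1) show thesis using that by blast
qed

text \<open>
  A basic open set of a product restricts finitely many coordinates. At a limit stage they lie
  below one earlier stage, whose coordinate then decides them all.
\<close>
lemma finite_below_wo_limit:
  assumes "Well_order r" "wo_limit r \<gamma>" "finite N" "N \<subseteq> underS r \<gamma>"
  shows "\<exists>\<alpha>\<in>underS r \<gamma>. N \<subseteq> underS r \<alpha>"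
  using assms(3,4)
proof (induction N)
  case empty
  have "underS r \<gamma> \<noteq> {}"
    using assms(2) by (auto simp: wo_limit_def wo_zero_def)
  then show ?case by auto
next
  case (insert \<beta> N)
  then obtain \<alpha> where \<alpha>: "\<alpha> \<in> underS r \<gamma>" "N \<subseteq> underS r \<alpha>" by auto
  obtain \<delta> where \<delta>: "\<delta> \<in> underS r \<gamma>" "\<beta> \<in> underS r \<delta>"
    using wo_limit_between[OF assms(1,2)] insert.prems by blast
  have "\<alpha> \<in> Field r" "\<delta> \<in> Field r"
    using \<alpha>(1) \<delta>(1) by (auto simp: underS_def Field_def)
  then consider "\<alpha> \<in> underS r \<delta>" | "\<alpha> = \<delta>" | "\<delta> \<in> underS r \<alpha>"
    using Well_order_linear[OF assms(1)] by blast
  then show ?case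
  proof cases
    case 1
    with \<alpha>(2) \<delta> have "insert \<beta> N \<subseteq> underS r \<delta>"
      using Well_order_underS_trans[OF assms(1)] by blast
    then show ?thesis using \<delta>(1) by blast
  next
    case 2
    then show ?thesis using \<alpha> \<delta> by auto
  next
    case 3
    with \<alpha> \<delta> have "insert \<beta> N \<subseteq> underS r \<alpha>"
      using Well_order_underS_trans[OF assms(1)] by blast
    then show ?thesis using \<alpha>(1) by blast
  qed
qed

lemma topspace_inverse_limit:
  "z \<in> topspace (inverse_limit r I X p) \<longleftrightarrow>
    z \<in> (\<Pi>\<^sub>E i\<in>I. topspace (X i)) \<and> (\<forall>\<beta>\<in>I. \<forall>\<alpha>\<in>I \<inter> underS r \<beta>. p \<alpha> \<beta> (z \<beta>) = z \<alpha>)"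
  by (auto simp: inverse_limit_def)

lemma continuous_map_inverse_limit_projection:
  "i \<in> I \<Longrightarrow> continuous_map (inverse_limit r I X p) (X i) (\<lambda>z. z i)"
  unfolding inverse_limit_def
  by (intro continuous_map_from_subtopology continuous_map_product_projection)

text \<open>
  The stage \<open>F \<alpha>\<close> consists of \<open>B\<close> and of countable sets \<open>\<Phi> \<beta>\<close>, one for each \<open>\<beta> < \<alpha>\<close>, and \<open>X\<^sub>\<alpha>\<close> is the quotient by
  \<open>F \<alpha>\<close>. The bonding map from stage \<open>\<beta>\<close> to stage \<open>\<alpha>\<close> picks the representative for \<open>F \<alpha>\<close>, whatever \<open>\<beta>\<close> is.
  A successor stage adds the functions of one \<open>\<Phi> \<alpha>\<close>, so it embeds in the product of the previous
  stage with the separable metrizable quotient by \<open>\<Phi> \<alpha>\<close>. Every function of a limit stage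
  occurs at an earlier stage, so the limit stage embeds in the inverse limit; its image is dense because a
  point of the inverse limit agrees, up to any given stage, with the image of one of its coordinates.
  
  The functions needed to recover the topology of \<open>X\<close> are listed before some stage \<open>a\<close> that is not the
  end of the system. So the projection from the limit to \<open>X\<^sub>a\<close> is a homeomorphism onto \<open>X\<close>, and every continuous
  function on the limit factors through it.
\<close>
theorem Dugundji_space_by_functions:
  fixes X :: "'a topology"
  assumes Tych: "Tychonoff_space X"
    and cont: "\<And>F f. good F \<Longrightarrow> f \<in> F \<Longrightarrow> continuous_map X euclideanreal f"
    and union: "\<And>\<F>. \<F> \<noteq> {} \<Longrightarrow> \<forall>F\<in>\<F>. good F \<Longrightarrow> good (\<Union>\<F>)"
    and base: "countable B" "good B"
    and separate: "\<And>x W. openin X W \<Longrightarrow> x \<in> W \<Longrightarrow>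
      \<exists>F. countable F \<and> good F \<and> (\<exists>V. openin (initial_topology (topspace X) F) V \<and> x \<in> V \<and> V \<subseteq> W)"
    and bonding: "\<And>F F'. good F \<Longrightarrow> good F' \<Longrightarrow> B \<subseteq> F \<Longrightarrow> F \<subseteq> F' \<Longrightarrow>
      P (function_quotient (topspace X) F') (function_quotient (topspace X) F) (representative (topspace X) F)"
  shows "Dugundji_space P X"
proof -
  let ?E = "topspace X"
  let ?Q = "function_quotient ?E" and ?rep = "representative ?E"
  obtain r :: "('a \<Rightarrow> real) set rel" and a and \<iota> :: "('a \<Rightarrow> real) \<Rightarrow> ('a \<Rightarrow> real) set"
    where r: "Card_order r" "Field r = UNIV" and \<iota>: "inj \<iota>" "\<And>c. \<iota> c \<in> underS r a"
    by (rule longer_Card_order) blast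
  have wo: "Well_order r" using r(1) by (simp add: card_order_on_well_order_on)
  define fits where "fits x W S \<longleftrightarrow> countable S \<and> good S \<and> (openin X W \<and> x \<in> W \<longrightarrow>
      (\<exists>V. openin (initial_topology ?E S) V \<and> x \<in> V \<and> V \<subseteq> W))" for x W S
  have "\<exists>S. fits x W S" for x W
  proof (cases "openin X W \<and> x \<in> W")
    case True
    then show ?thesis using separate[of W x] by (simp add: fits_def)
  next
    case False
    then have "fits x W B" using base by (auto simp: fits_def)
    then show ?thesis by blast
  qed
  then have fits: "fits x W (SOME S. fits x W S)" for x W by (rule someI_ex)
  define s where "s x W = (SOME S. fits x W S)" for x W
  have fits_s: "fits x W (s x W)" for x W
    unfolding s_def by (rule fits)
  have s: "countable (s x W)" "good (s x W)"
    "openin X W \<and> x \<in> W \<longrightarrow> (\<exists>V. openin (initial_topology ?E (s x W)) V \<and> x \<in> V \<and> V \<subseteq> W)" for x W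
    using fits_s[of x W] unfolding fits_def by blast+
  \<comment> \<open>A pair \<open>x \<in> W\<close> is coded by the function with value 2 at \<open>x\<close>, 1 on the rest of \<open>W\<close>
    and 0 elsewhere.\<close>
  define \<Phi> where "\<Phi> \<beta> = (let c = inv_into UNIV \<iota> \<beta> in s (THE y. c y = (2::real)) {y. c y \<noteq> 0})" for \<beta>
  have \<Phi>: "countable (\<Phi> \<beta>)" "good (\<Phi> \<beta>)" for \<beta>
    using s(1,2) by (simp_all add: \<Phi>_def Let_def)
  have \<Phi>_all: "\<exists>\<beta>\<in>underS r a. \<Phi> \<beta> = s x W" if "x \<in> W" for x W
  proof -
    define c where "c y = (if y = x then 2 else if y \<in> W then 1 else (0::real))" for y
    have "(THE y. c y = 2) = x"
      by (rule the_equality) (auto simp: c_def split: if_splits)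
    moreover have "{y. c y \<noteq> 0} = W"
      using that by (auto simp: c_def)
    ultimately have "\<Phi> (\<iota> c) = s x W"
      using \<iota>(1) by (simp add: \<Phi>_def Let_def)
    then show ?thesis using \<iota>(2) by blast
  qed
  define F where "F \<alpha> = B \<union> (\<Union>\<beta>\<in>underS r \<alpha>. \<Phi> \<beta>)" for \<alpha>
  have B: "B \<subseteq> F \<alpha>" for \<alpha> by (auto simp: F_def)
  have good: "good (F \<alpha>)" for \<alpha>
  proof -
    have "F \<alpha> = \<Union>(insert B (\<Phi> ` underS r \<alpha>))" by (auto simp: F_def)
    then show ?thesis using union[of "insert B (\<Phi> ` underS r \<alpha>)"] base(2) \<Phi>(2) by simp
  qed
  have mono: "F \<alpha> \<subseteq> F \<beta>" if "\<alpha> \<in> underS r \<beta>" for \<alpha> \<beta>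
    using that Well_order_underS_trans[OF wo] by (auto simp: F_def)
  let ?X = "\<lambda>\<alpha>. ?Q (F \<alpha>)" and ?p = "\<lambda>\<alpha> \<beta>. ?rep (F \<alpha>)"
  have contF: "continuous_map X euclideanreal f" if "f \<in> F \<alpha>" for f \<alpha>
    using cont good that by blast
  have contrep: "continuous_map X (?X \<alpha>) (?rep (F \<alpha>))" for \<alpha>
    using contF by (intro continuous_map_representative) auto
  \<comment> \<open>Each pair \<open>x \<in> W\<close> has been treated before stage \<open>a\<close>, so the initial topology of \<open>F a\<close> is that
    of \<open>X\<close>. As \<open>X\<close> is a \<open>T\<^sub>1\<close> space, every point is then its own representative.\<close>
  have fine: "continuous_map (?X a) X (\<lambda>x. x)"
    unfolding continuous_map_def
  proof (intro conjI allI impI)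
    show "(\<lambda>x. x) \<in> topspace (?X a) \<rightarrow> topspace X"
      using quotient_point_in[of _ ?E] by auto
    fix W assume W: "openin X W"
    have "openin (initial_topology ?E (F a)) W"
    proof (subst openin_subopen, intro ballI)
      fix x assume x: "x \<in> W"
      then obtain \<beta> where \<beta>: "\<beta> \<in> underS r a" "\<Phi> \<beta> = s x W" using \<Phi>_all by blast
      obtain V where V: "openin (initial_topology ?E (\<Phi> \<beta>)) V" "x \<in> V" "V \<subseteq> W"
        using s(3)[of W x] W x \<beta>(2) by auto
      have "openin (initial_topology ?E (F a)) V"
        by (rule openin_initial_mono[OF V(1)]) (use \<beta>(1) in \<open>auto simp: F_def\<close>)
      then show "\<exists>T. openin (initial_topology ?E (F a)) T \<and> x \<in> T \<and> T \<subseteq> W"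
        using V by blast
    qed
    then have "openin (?X a) (W \<inter> ?rep (F a) ` ?E)"
      unfolding function_quotient_def by (auto simp: openin_subtopology)
    moreover have "{x \<in> topspace (?X a). x \<in> W} = W \<inter> ?rep (F a) ` ?E" by auto
    ultimately show "openin (?X a) {x \<in> topspace (?X a). x \<in> W}" by simp
  qed
  have rep_a: "?rep (F a) x = x" if xE: "x \<in> ?E" for x
  proof (rule ccontr)
    assume neq: "?rep (F a) x \<noteq> x"
    have "t1_space X"
      using Tych by (simp add: Tychonoff_space_def Hausdorff_imp_t1_space)
    then obtain W where W: "openin X W" "x \<in> W" "?rep (F a) x \<notin> W"
      using neq xE representative_in[OF xE, of "F a"] unfolding t1_space_def by metis
    obtain \<beta> where \<beta>: "\<beta> \<in> underS r a" "\<Phi> \<beta> = s x W" using \<Phi>_all W(2) by blast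
    obtain V where V: "openin (initial_topology ?E (\<Phi> \<beta>)) V" "x \<in> V" "V \<subseteq> W"
      using s(3)[of W x] W \<beta>(2) by auto
    have "?rep (F a) x \<in> V"
    proof (rule openin_initial_saturated[OF V(1,2)])
      show "?rep (F a) x \<in> ?E" by (rule representative_in[OF xE])
      fix f assume "f \<in> \<Phi> \<beta>"
      then have "f \<in> F a" using \<beta>(1) by (auto simp: F_def)
      then show "f x = f (?rep (F a) x)" using representative_value[OF xE] by metis
    qed
    with V(3) W(3) show False by blast
  qed
  have rep_above: "?rep (F \<alpha>) x = x" if "x \<in> ?E" "a \<in> underS r \<alpha>" for x \<alpha>
    using representative_representative[OF that(1) mono[OF that(2)]] rep_a
      representative_in[OF that(1), of "F \<alpha>"] that(1) by metis

  have system: "inverse_system P r ?X ?p"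
    unfolding inverse_system_def
  proof (intro conjI ballI)
    show "Card_order r" "Field r \<noteq> {}" using r by auto
    show "Tychonoff_space (?X \<alpha>)" for \<alpha> by (rule Tychonoff_space_quotient)
    fix \<beta> \<alpha> assume \<alpha>\<beta>: "\<alpha> \<in> underS r \<beta>"
    show "P (?X \<beta>) (?X \<alpha>) (?p \<alpha> \<beta>)"
      by (rule bonding[OF good good B mono[OF \<alpha>\<beta>]])
    have "?rep (F \<alpha>) ` ?rep (F \<beta>) ` ?E = ?rep (F \<alpha>) ` ?E"
      unfolding image_image by (rule image_cong) (simp_all add: representative_representative mono[OF \<alpha>\<beta>])
    then show "?p \<alpha> \<beta> ` topspace (?X \<beta>) = topspace (?X \<alpha>)" by simp
  next
    fix \<gamma> \<beta> \<alpha> x assume "\<beta> \<in> underS r \<gamma>" and \<alpha>\<beta>: "\<alpha> \<in> underS r \<beta>" and "x \<in> topspace (?X \<gamma>)"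
    then have "x \<in> ?E" using quotient_point_in[of x ?E] by simp
    then show "?p \<alpha> \<beta> (?p \<beta> \<gamma> x) = ?p \<alpha> \<gamma> x"
      by (rule representative_representative[OF _ mono[OF \<alpha>\<beta>]])
  qed
  have zero: "separable_space (?X \<alpha>) \<and> metrizable_space (?X \<alpha>)" if "wo_zero r \<alpha>" for \<alpha>
  proof -
    have "F \<alpha> = B" using that by (auto simp: F_def wo_zero_def)
    then obtain M :: "real topology" and m where
      "metrizable_space M" "separable_space M" "homeomorphic_map (?X \<alpha>) M m"
      using quotient_coded_in_reals[OF base(1)] by metis
    then show ?thesis
      using homeomorphic_map_imp_homeomorphic_space homeomorphic_metrizable_space homeomorphic_separable_space
      by blast
  qed
  have succ: "metrizable_kernel (?X \<beta>) (?X \<alpha>) (?p \<alpha> \<beta>)" if "wo_succ r \<alpha> \<beta>" for \<alpha> \<beta>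
  proof -
    have F: "F \<beta> = F \<alpha> \<union> \<Phi> \<alpha>"
      using underS_succ[OF wo that] by (auto simp: F_def)
    obtain M :: "real topology" and m where
      M: "metrizable_space M" "separable_space M" "homeomorphic_map (?Q (\<Phi> \<alpha>)) M m"
      using quotient_coded_in_reals[OF \<Phi>(1)] by metis
    then obtain m' where m': "homeomorphic_maps (?Q (\<Phi> \<alpha>)) M m m'"
      by (auto simp: homeomorphic_map_maps)
    have \<Phi>_sub: "\<Phi> \<alpha> \<subseteq> F \<beta>" using F by blast
    let ?e = "\<lambda>x. (?rep (F \<alpha>) x, m (?rep (\<Phi> \<alpha>) x))"
    have sub: "topspace (?X \<beta>) \<subseteq> ?E" using quotient_point_in[of _ ?E] by auto
    have "embedding_map (?X \<beta>) (prod_topology (?X \<alpha>) M) ?e"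
    proof (rule embedding_map_quotient)
      have "continuous_map (?X \<beta>) (?X \<alpha>) (?rep (F \<alpha>))"
        by (rule continuous_map_representative[OF sub]) (use F continuous_map_quotient_member in blast)
      moreover have "continuous_map (?X \<beta>) (?Q (\<Phi> \<alpha>)) (?rep (\<Phi> \<alpha>))"
        by (rule continuous_map_representative[OF sub]) (use F continuous_map_quotient_member in blast)
      then have "continuous_map (?X \<beta>) M (m \<circ> ?rep (\<Phi> \<alpha>))"
        using m' continuous_map_compose by (auto simp: homeomorphic_maps_def)
      ultimately show "continuous_map (?X \<beta>) (prod_topology (?X \<alpha>) M) ?e"
        by (simp add: continuous_map_pairwise o_def)
      fix f assume "f \<in> F \<beta>"
      then consider "f \<in> F \<alpha>" | "f \<in> \<Phi> \<alpha>" using F by blast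
      then show "\<exists>\<psi>. continuous_map (prod_topology (?X \<alpha>) M) euclideanreal \<psi> \<and>
          (\<forall>x\<in>?rep (F \<beta>) ` ?E. \<psi> (?e x) = f x)"
      proof cases
        case 1
        have "continuous_map (prod_topology (?X \<alpha>) M) euclideanreal (f \<circ> fst)"
          by (intro continuous_map_compose[OF continuous_map_fst] continuous_map_quotient_member 1)
        moreover have "(f \<circ> fst) (?e x) = f x" if "x \<in> ?rep (F \<beta>) ` ?E" for x
          using 1 quotient_point_in[OF that] by (simp add: representative_value)
        ultimately show ?thesis by blast
      next
        case 2
        have "continuous_map M euclideanreal (f \<circ> m')"
          using m' continuous_map_compose continuous_map_quotient_member[OF 2]
          unfolding homeomorphic_maps_def by metis
        then have "continuous_map (prod_topology (?X \<alpha>) M) euclideanreal ((f \<circ> m') \<circ> snd)"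
          by (intro continuous_map_compose[OF continuous_map_snd])
        moreover have "((f \<circ> m') \<circ> snd) (?e x) = f x" if "x \<in> ?rep (F \<beta>) ` ?E" for x
        proof -
          have x: "x \<in> ?E" by (rule quotient_point_in[OF that])
          then have "m' (m (?rep (\<Phi> \<alpha>) x)) = ?rep (\<Phi> \<alpha>) x"
            using m' by (simp add: homeomorphic_maps_def)
          then show ?thesis using 2 x by (simp add: representative_value)
        qed
        ultimately show ?thesis by blast
      qed
    qed
    then show ?thesis
      unfolding metrizable_kernel_def using M(1,2) by (intro exI[of _ M] exI[of _ ?e]) simp
  qed
  have limit: "let L = inverse_limit r (underS r \<gamma>) ?X ?p; h = \<lambda>x. \<lambda>\<alpha>\<in>underS r \<gamma>. ?p \<alpha> \<gamma> x
      in embedding_map (?X \<gamma>) L h \<and> dense_subset L (h ` topspace (?X \<gamma>))"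
    if lim: "wo_limit r \<gamma>" for \<gamma>
  proof -
    let ?I = "underS r \<gamma>"
    define L where "L = inverse_limit r ?I ?X ?p"
    define h where "h x = (\<lambda>\<alpha>\<in>?I. ?rep (F \<alpha>) x)" for x
    have sub: "topspace (?X \<gamma>) \<subseteq> ?E" using quotient_point_in[of _ ?E] by auto
    have hL: "h x \<in> topspace L" if "x \<in> ?E" for x
      unfolding L_def topspace_inverse_limit
      using that by (auto simp: h_def representative_representative mono)
    have emb: "embedding_map (?X \<gamma>) L h"
    proof (rule embedding_map_quotient)
      have "continuous_map (?X \<gamma>) (?X \<alpha>) (?rep (F \<alpha>))" if "\<alpha> \<in> ?I" for \<alpha>
        by (rule continuous_map_representative[OF sub])
           (use mono[OF that] continuous_map_quotient_member in blast)
      then have "continuous_map (?X \<gamma>) (product_topology ?X ?I) h"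
        by (auto simp: continuous_map_componentwise h_def cong: restrict_cong)
      then show "continuous_map (?X \<gamma>) L h"
        unfolding L_def inverse_limit_def
      proof (rule continuous_map_into_subtopology)
        show "h \<in> topspace (?X \<gamma>) \<rightarrow> {z. \<forall>\<beta>\<in>?I. \<forall>\<alpha>\<in>?I \<inter> underS r \<beta>. ?p \<alpha> \<beta> (z \<beta>) = z \<alpha>}"
          using hL sub unfolding L_def topspace_inverse_limit by blast
      qed
      fix f assume "f \<in> F \<gamma>"
      then have "\<exists>\<alpha>\<in>?I. f \<in> F \<alpha>"
      proof (cases "f \<in> B")
        case True
        then show ?thesis using lim B by (auto simp: wo_limit_def wo_zero_def)
      next
        case False
        then obtain \<beta> where \<beta>: "\<beta> \<in> ?I" "f \<in> \<Phi> \<beta>" using \<open>f \<in> F \<gamma>\<close> by (auto simp: F_def)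
        obtain \<alpha> where "\<alpha> \<in> ?I" "\<beta> \<in> underS r \<alpha>"
          using wo_limit_between[OF wo lim \<beta>(1)] by blast
        then show ?thesis using \<beta>(2) by (auto simp: F_def)
      qed
      then obtain \<alpha> where \<alpha>: "\<alpha> \<in> ?I" "f \<in> F \<alpha>" by blast
      have "continuous_map L euclideanreal (f \<circ> (\<lambda>z. z \<alpha>))"
        unfolding L_def
        by (intro continuous_map_compose[OF continuous_map_inverse_limit_projection[OF \<alpha>(1)]]
            continuous_map_quotient_member \<alpha>(2))
      moreover have "(f \<circ> (\<lambda>z. z \<alpha>)) (h x) = f x" if "x \<in> ?rep (F \<gamma>) ` ?E" for x
        using \<alpha> quotient_point_in[OF that] by (simp add: h_def representative_value)
      ultimately show "\<exists>\<psi>. continuous_map L euclideanreal \<psi> \<and> (\<forall>x\<in>?rep (F \<gamma>) ` ?E. \<psi> (h x) = f x)"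
        by blast
    qed
    have "L closure_of h ` topspace (?X \<gamma>) = topspace L"
    proof (intro equalityI subsetI)
      show "z \<in> topspace L" if "z \<in> L closure_of h ` topspace (?X \<gamma>)" for z
        using that by (simp add: in_closure_of)
      fix z assume z: "z \<in> topspace L"
      show "z \<in> L closure_of h ` topspace (?X \<gamma>)"
        unfolding in_closure_of
      proof (intro conjI allI impI z, elim conjE)
        fix W assume zW: "z \<in> W" and "openin L W"
        then obtain W' where W': "openin (product_topology ?X ?I) W'"
          "W = W' \<inter> {z. \<forall>\<beta>\<in>?I. \<forall>\<alpha>\<in>?I \<inter> underS r \<beta>. ?p \<alpha> \<beta> (z \<beta>) = z \<alpha>}"
          unfolding L_def inverse_limit_def openin_subtopology by blast
        have "z \<in> W'" using zW W'(2) by blast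
        then obtain U where U: "finite {i \<in> ?I. U i \<noteq> topspace (?X i)}" "z \<in> Pi\<^sub>E ?I U" "Pi\<^sub>E ?I U \<subseteq> W'"
          using W'(1)[unfolded openin_product_topology_alt] by (auto dest: bspec)
        obtain \<alpha> where \<alpha>: "\<alpha> \<in> ?I" "{i \<in> ?I. U i \<noteq> topspace (?X i)} \<subseteq> underS r \<alpha>"
          using finite_below_wo_limit[OF wo lim U(1)] by blast
        have "z \<alpha> \<in> ?rep (F \<alpha>) ` ?E"
          using z \<alpha>(1) unfolding L_def topspace_inverse_limit by auto
        then have x: "z \<alpha> \<in> ?E" by (rule quotient_point_in)
        have "h (z \<alpha>) i \<in> U i" if i: "i \<in> ?I" for i
        proof (cases "U i = topspace (?X i)")
          case True
          then show ?thesis using x i by (simp add: h_def)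
        next
          case False
          then have "i \<in> underS r \<alpha>" using \<alpha>(2) i by blast
          then have "?rep (F i) (z \<alpha>) = z i"
            using z \<alpha>(1) i unfolding L_def topspace_inverse_limit by blast
          then show ?thesis using U(2) i by (auto simp: h_def)
        qed
        then have "h (z \<alpha>) \<in> Pi\<^sub>E ?I U" by (auto simp: h_def)
        with U(3) W'(2) hL[OF x] have "h (z \<alpha>) \<in> W"
          unfolding L_def topspace_inverse_limit by auto
        moreover have "h (?rep (F \<gamma>) (z \<alpha>)) = h (z \<alpha>)"
          unfolding h_def by (rule restrict_ext) (simp add: representative_representative x mono)
        moreover have "h (?rep (F \<gamma>) (z \<alpha>)) \<in> h ` topspace (?X \<gamma>)"
          using x by (intro imageI) simp
        ultimately show "\<exists>y. y \<in> h ` topspace (?X \<gamma>) \<and> y \<in> W" by metis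
      qed
    qed
    moreover have "h ` topspace (?X \<gamma>) \<subseteq> topspace L" using hL sub by blast
    ultimately have "dense_subset L (h ` topspace (?X \<gamma>))"
      unfolding dense_subset_def by blast
    with emb show ?thesis unfolding Let_def L_def h_def by blast
  qed
  define L where "L = inverse_limit r (Field r) ?X ?p"
  define e where "e x = (\<lambda>\<alpha>\<in>Field r. ?rep (F \<alpha>) x)" for x
  have eL: "e x \<in> topspace L" if "x \<in> ?E" for x
    unfolding L_def topspace_inverse_limit
    using that by (auto simp: e_def representative_representative mono)
  have e_cont: "continuous_map X L e"
  proof -
    have "continuous_map X (product_topology ?X (Field r)) e"
      using contrep by (auto simp: continuous_map_componentwise e_def cong: restrict_cong)
    then show ?thesis
      unfolding L_def inverse_limit_def
    proof (rule continuous_map_into_subtopology)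
      show "e \<in> topspace X \<rightarrow> {z. \<forall>\<beta>\<in>Field r. \<forall>\<alpha>\<in>Field r \<inter> underS r \<beta>. ?p \<alpha> \<beta> (z \<beta>) = z \<alpha>}"
        using eL unfolding L_def topspace_inverse_limit by blast
    qed
  qed
  have aL: "continuous_map L (?X a) (\<lambda>z. z a)"
    unfolding L_def by (rule continuous_map_inverse_limit_projection) (simp add: r(2))
  have ea: "e x a = x" if "x \<in> ?E" for x
    using rep_a[OF that] r(2) by (simp add: e_def)
  \<comment> \<open>A thread is determined by its coordinate at \<open>a\<close>: the bonding maps give the earlier coordinates,
    and after stage \<open>a\<close> all coordinates are equal because no two points are identified.\<close>
  have ze: "z a \<in> ?E \<and> e (z a) = z" if z: "z \<in> topspace L" for z
  proof
    have zE: "z \<alpha> \<in> ?E" for \<alpha>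
      using z r(2) quotient_point_in[of "z \<alpha>" ?E "F \<alpha>"] unfolding L_def topspace_inverse_limit by auto
    then show "z a \<in> ?E" .
    show "e (z a) = z"
    proof
      fix \<alpha>
      consider "\<alpha> \<in> underS r a" | "\<alpha> = a" | "a \<in> underS r \<alpha>"
        using Well_order_linear[OF wo] r(2) by blast
      then show "e (z a) \<alpha> = z \<alpha>"
      proof cases
        case 1
        then show ?thesis
          using z r(2) unfolding L_def topspace_inverse_limit by (simp add: e_def)
      next
        case 2
        then show ?thesis using ea zE by simp
      next
        case 3
        then have "?rep (F a) (z \<alpha>) = z a"
          using z r(2) unfolding L_def topspace_inverse_limit by simp
        then have "z \<alpha> = z a" using rep_a zE by simp
        then show ?thesis using rep_above[OF zE 3] r(2) by (simp add: e_def)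
      qed
    qed
  qed
  have "homeomorphic_maps X L e (\<lambda>z. z a)"
    unfolding homeomorphic_maps_def
    using e_cont continuous_map_compose[OF aL fine] ea ze by (auto simp: o_def)
  then have e_hom: "homeomorphic_map X L e" by (rule homeomorphic_maps_imp_map)
  then have e_emb: "embedding_map X L e"
    using surjective_embedding_map by blast
  have e_coord: "(\<lambda>z. e z \<alpha>) ` topspace X = topspace (?X \<alpha>)" for \<alpha>
    using r(2) by (simp add: e_def)
  have factor: "\<exists>g. continuous_map (?X a) euclideanreal g \<and> (\<forall>z\<in>topspace L. f z = g (z a))"
    if "continuous_map L euclideanreal f" for f
  proof (intro exI conjI ballI)
    show "continuous_map (?X a) euclideanreal (f \<circ> (e \<circ> (\<lambda>x. x)))"
      by (intro continuous_map_compose[OF _ that] continuous_map_compose[OF fine] e_cont)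
    show "f z = (f \<circ> (e \<circ> (\<lambda>x. x))) (z a)" if "z \<in> topspace L" for z
      using ze[OF that] by simp
  qed
  show ?thesis
    unfolding Dugundji_space_def
  proof (intro exI[of _ r] exI[of _ ?X] exI[of _ ?p] conjI system allI impI)
    show "separable_space (?X \<alpha>)" "metrizable_space (?X \<alpha>)" if "wo_zero r \<alpha>" for \<alpha>
      using zero[OF that] by auto
    show "let L = inverse_limit r (Field r) ?X ?p
      in (\<exists>e. embedding_map X L e \<and> (\<forall>\<alpha>\<in>Field r. (\<lambda>z. e z \<alpha>) ` topspace X = topspace (?X \<alpha>))) \<and>
         (\<forall>f. continuous_map L euclideanreal f \<and> bounded (f ` topspace L) \<longrightarrow>
              (\<exists>\<alpha>\<in>Field r. \<exists>g. continuous_map (?X \<alpha>) euclideanreal g \<and> (\<forall>z\<in>topspace L. f z = g (z \<alpha>))))"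
      unfolding Let_def L_def[symmetric]
    proof (intro conjI allI impI)
      show "\<exists>e. embedding_map X L e \<and> (\<forall>\<alpha>\<in>Field r. (\<lambda>z. e z \<alpha>) ` topspace X = topspace (?X \<alpha>))"
        by (intro exI[of _ e] conjI ballI e_emb e_coord)
      fix f assume "continuous_map L euclideanreal f \<and> bounded (f ` topspace L)"
      then show "\<exists>\<alpha>\<in>Field r. \<exists>g. continuous_map (?X \<alpha>) euclideanreal g \<and> (\<forall>z\<in>topspace L. f z = g (z \<alpha>))"
        by (intro bexI[of _ a] factor) (simp_all add: r(2))
    qed
  qed (fact succ limit)+
qed

section \<open>Complete sequences of open covers\<close>

text \<open>
  The internal characterization of Cech-completeness of \<open>D\<close> by a complete sequence of open covers,
  with covers by open sets of the ambient space, so that it applies also to topologies on \<open>X\<close>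
  in which \<open>D\<close> is just a dense set.
\<close>
definition complete_covers :: "'a topology \<Rightarrow> 'a set \<Rightarrow> (nat \<Rightarrow> 'a set set) \<Rightarrow> bool"
  where "complete_covers X D \<C> \<longleftrightarrow>
    (\<forall>n. (\<forall>U\<in>\<C> n. openin X U) \<and> D \<subseteq> \<Union>(\<C> n)) \<and>
    (\<forall>\<F>. (\<forall>F\<in>\<F>. F \<subseteq> D) \<and> (\<forall>\<G>\<subseteq>\<F>. finite \<G> \<longrightarrow> D \<inter> \<Inter>\<G> \<noteq> {}) \<and>
      (\<forall>n. \<exists>F\<in>\<F>. \<exists>U\<in>\<C> n. F \<subseteq> U) \<longrightarrow> (\<exists>z\<in>D. \<forall>F\<in>\<F>. z \<in> X closure_of F))"

lemma regular_space_shrink: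
  assumes "regular_space X" "openin X W" "x \<in> W"
  obtains V where "openin X V" "x \<in> V" "X closure_of V \<subseteq> W"
proof -
  have "closedin X (topspace X - W)" using assms(2) by blast
  moreover have "x \<in> topspace X - (topspace X - W)"
    using assms(2,3) openin_subset by blast
  ultimately obtain V where V: "openin X V" "x \<in> V" "disjnt (topspace X - W) (X closure_of V)"
    using assms(1) unfolding regular_space by blast
  have "X closure_of V \<subseteq> W"
    using V(3) closure_of_subset_topspace[of X V] by (auto simp: disjnt_def)
  with V that show thesis by blast
qed

lemma compact_Hausdorff_Stone_Cech:
  shows "compact_space (Stone_Cech Y)" "Hausdorff_space (Stone_Cech Y)"
proof -
  let ?cube = "product_topology (\<lambda>_. top_of_set {0..1::real}) (unit_functions Y)"
  have "compact_space ?cube"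
    by (simp add: compact_space_product_topology compact_space_subtopology)
  then show "compact_space (Stone_Cech Y)"
    unfolding Stone_Cech_def Let_def
    by (intro compact_space_subtopology closedin_compact_space closedin_closure_of)
  have "Hausdorff_space ?cube"
    by (simp add: Hausdorff_space_product_topology Hausdorff_space_subtopology)
  then show "Hausdorff_space (Stone_Cech Y)"
    unfolding Stone_Cech_def Let_def by (rule Hausdorff_space_subtopology)
qed

lemma continuous_map_Stone_Cech_map: "continuous_map Y (Stone_Cech Y) (Stone_Cech_map Y)"
proof -
  let ?cube = "product_topology (\<lambda>_. top_of_set {0..1::real}) (unit_functions Y)"
  have cont: "continuous_map Y ?cube (Stone_Cech_map Y)"
    unfolding continuous_map_componentwise
  proof (intro conjI ballI)
    show "Stone_Cech_map Y ` topspace Y \<subseteq> extensional (unit_functions Y)"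
      by (auto simp: Stone_Cech_map_def)
    fix f assume f: "f \<in> unit_functions Y"
    then have "continuous_map Y (top_of_set {0..1}) f" by (simp add: unit_functions_def)
    then show "continuous_map Y (top_of_set {0..1}) (\<lambda>x. Stone_Cech_map Y x f)"
      by (rule continuous_map_eq) (use f in \<open>simp add: Stone_Cech_map_def\<close>)
  qed
  then have "Stone_Cech_map Y ` topspace Y \<subseteq> ?cube closure_of (Stone_Cech_map Y ` topspace Y)"
    by (intro closure_of_subset) (auto simp: continuous_map_def)
  with cont show ?thesis
    unfolding Stone_Cech_def Let_def by (intro continuous_map_into_subtopology) auto
qed

text \<open>
  If \<open>d\<close> is not in the closure of \<open>F\<close>, complete regularity gives a coordinate of the cube that is
  0 at the image of \<open>d\<close> and 1 on the image of \<open>F\<close>.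
\<close>
lemma Stone_Cech_map_reflects_closure:
  assumes "Tychonoff_space Y" "d \<in> topspace Y" "F \<subseteq> topspace Y"
    and "Stone_Cech_map Y d \<in> Stone_Cech Y closure_of (Stone_Cech_map Y ` F)"
  shows "d \<in> Y closure_of F"
proof (rule ccontr)
  assume d: "d \<notin> Y closure_of F"
  have "completely_regular_space Y" using assms(1) by (simp add: Tychonoff_space_def)
  then obtain f where f: "continuous_map Y (top_of_set {0..1::real}) f" "f d = 0" "f ` (Y closure_of F) \<subseteq> {1}"
    unfolding completely_regular_space_def using assms(2) d by (metis DiffI closedin_closure_of)
  define f' where "f' = restrict f (topspace Y)"
  have f': "f' \<in> unit_functions Y"
    unfolding unit_functions_def f'_def using continuous_map_eq[OF f(1), of "restrict f (topspace Y)"] by simp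
  have coord: "continuous_map (Stone_Cech Y) euclideanreal (\<lambda>w. w f')"
    unfolding Stone_Cech_def Let_def
    using continuous_map_product_projection[OF f', of "\<lambda>_. top_of_set {0..1::real}"]
    by (intro continuous_map_from_subtopology) (simp add: continuous_map_in_subtopology)
  define W where "W = {w \<in> topspace (Stone_Cech Y). w f' \<in> {..<1}}"
  have "openin (Stone_Cech Y) W"
    unfolding W_def by (rule openin_continuous_map_preimage[OF coord]) simp
  moreover have "Stone_Cech_map Y d \<in> W"
    using assms(2,4) f(2) f' by (simp add: W_def in_closure_of Stone_Cech_map_def f'_def)
  ultimately obtain x where x: "x \<in> F" "Stone_Cech_map Y x \<in> W"
    using assms(4) unfolding in_closure_of by blast
  have xt: "x \<in> topspace Y" using x(1) assms(3) by blast
  have "f x = 1" using f(3) closure_of_subset[OF assms(3)] x(1) by blast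
  then show False
    using x(2) f' xt by (simp add: W_def Stone_Cech_map_def f'_def)
qed

text \<open>
  In its Stone-Cech compactification, \<open>D\<close> is the intersection of open sets \<open>G n\<close>. The members of the \<open>n\<close>-th
  cover have their trace on \<open>D\<close> in an open set with closure inside \<open>G n\<close>. A family with the finite
  intersection property clusters somewhere in the compactification, and if it is fine for all
  covers, then the cluster point is in every \<open>G n\<close>, hence in \<open>D\<close>.
\<close>
lemma Cech_complete_imp_complete_covers:
  assumes cech: "Cech_complete_space (subtopology X D)" and D: "D \<subseteq> topspace X"
  obtains \<C> where "complete_covers X D \<C>"
proof -
  let ?Y = "subtopology X D" and ?\<beta> = "Stone_Cech_map (subtopology X D)"
  let ?K = "Stone_Cech (subtopology X D)"
  have top: "topspace ?Y = D" using D by auto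
  have Tych: "Tychonoff_space ?Y" using cech by (simp add: Cech_complete_space_def)
  have \<beta>K: "?\<beta> ` D \<subseteq> topspace ?K"
    using continuous_map_Stone_Cech_map[of ?Y] top by (auto simp: continuous_map_def)
  obtain \<U> where \<U>: "countable \<U>" "\<forall>U\<in>\<U>. openin ?K U" "\<Inter>\<U> = ?\<beta> ` D"
    using cech unfolding Cech_complete_space_def gdelta_in_alt intersection_of_def top by blast
  \<comment> \<open>The whole space is added because the countable family may be empty.\<close>
  define G where "G n = from_nat_into (insert (topspace ?K) \<U>) n" for n
  have "range G = insert (topspace ?K) \<U>"
    unfolding G_def using \<U>(1) by (simp add: range_from_nat_into)
  then have G: "openin ?K (G n)" "\<Inter>(range G) = ?\<beta> ` D" for n
    using \<U>(2,3) \<beta>K rangeI[of G n] by auto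
  have reg: "regular_space ?K"
    by (rule compact_Hausdorff_imp_regular_space[OF compact_Hausdorff_Stone_Cech])
  define \<C> where "\<C> n = {U. openin X U \<and>
    (\<exists>V. openin ?K V \<and> ?K closure_of V \<subseteq> G n \<and> ?\<beta> ` (U \<inter> D) \<subseteq> V)}" for n
  have "complete_covers X D \<C>"
    unfolding complete_covers_def
  proof (intro conjI allI ballI subsetI impI)
    show "openin X U" if "U \<in> \<C> n" for n U using that by (simp add: \<C>_def)
    fix n d assume d: "d \<in> D"
    then have "?\<beta> d \<in> G n" using G(2) by blast
    then obtain V where V: "openin ?K V" "?\<beta> d \<in> V" "?K closure_of V \<subseteq> G n"
      using regular_space_shrink[OF reg G(1)] by metis
    have "openin ?Y {y \<in> topspace ?Y. ?\<beta> y \<in> V}"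
      by (rule openin_continuous_map_preimage[OF continuous_map_Stone_Cech_map V(1)])
    then obtain U where U: "openin X U" "{y \<in> topspace ?Y. ?\<beta> y \<in> V} = U \<inter> D"
      unfolding openin_subtopology by blast
    have "U \<in> \<C> n" unfolding \<C>_def using U V by blast
    moreover have "d \<in> U" using U(2) V(2) d top by blast
    ultimately show "d \<in> \<Union>(\<C> n)" by blast
  next
    fix \<F> assume "(\<forall>F\<in>\<F>. F \<subseteq> D) \<and> (\<forall>\<G>\<subseteq>\<F>. finite \<G> \<longrightarrow> D \<inter> \<Inter>\<G> \<noteq> {}) \<and>
      (\<forall>n. \<exists>F\<in>\<F>. \<exists>U\<in>\<C> n. F \<subseteq> U)"
    then have sub: "\<And>F. F \<in> \<F> \<Longrightarrow> F \<subseteq> D" and fip: "\<And>\<G>. \<G> \<subseteq> \<F> \<Longrightarrow> finite \<G> \<Longrightarrow> D \<inter> \<Inter>\<G> \<noteq> {}"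
      and small: "\<And>n. \<exists>F\<in>\<F>. \<exists>U\<in>\<C> n. F \<subseteq> U" by auto
    let ?cl = "\<lambda>F. ?K closure_of (?\<beta> ` F)"
    have "\<Inter>(?cl ` \<F>) \<noteq> {}"
    proof -
      have "\<Inter>\<H> \<noteq> {}" if \<H>: "finite \<H>" "\<H> \<subseteq> ?cl ` \<F>" for \<H>
      proof -
        obtain \<G> where \<G>: "\<G> \<subseteq> \<F>" "finite \<G>" "\<H> = ?cl ` \<G>"
          using finite_subset_image[OF \<H>] by blast
        obtain x where x: "x \<in> D \<inter> \<Inter>\<G>" using fip[OF \<G>(1,2)] by blast
        have "?\<beta> x \<in> ?cl F" if "F \<in> \<G>" for F
        proof -
          have "?\<beta> ` F \<subseteq> topspace ?K" using \<beta>K sub \<G>(1) that by blast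
          then have "?\<beta> ` F \<subseteq> ?cl F" by (rule closure_of_subset)
          then show ?thesis using x that by blast
        qed
        then show ?thesis using \<G>(3) by blast
      qed
      then have "(\<forall>C\<in>?cl ` \<F>. closedin ?K C) \<and> (\<forall>\<H>. finite \<H> \<and> \<H> \<subseteq> ?cl ` \<F> \<longrightarrow> \<Inter>\<H> \<noteq> {})"
        by simp
      then show ?thesis
        by (rule compact_Hausdorff_Stone_Cech(1)[of ?Y, unfolded compact_space_fip, THEN spec, THEN mp])
    qed
    then obtain z where z: "\<And>F. F \<in> \<F> \<Longrightarrow> z \<in> ?cl F" by blast
    have "z \<in> G n" for n
    proof -
      obtain F U V where F: "F \<in> \<F>" "F \<subseteq> U" "?K closure_of V \<subseteq> G n" "?\<beta> ` (U \<inter> D) \<subseteq> V"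
        using small[of n] unfolding \<C>_def by blast
      have "?\<beta> ` F \<subseteq> V" using F sub[OF F(1)] by blast
      then have "?cl F \<subseteq> ?K closure_of V" by (rule closure_of_mono)
      then show ?thesis using z[OF F(1)] F(3) by blast
    qed
    then obtain d where d: "d \<in> D" "z = ?\<beta> d" using G(2) by blast
    have "d \<in> X closure_of F" if "F \<in> \<F>" for F
    proof -
      have "d \<in> ?Y closure_of F"
        by (rule Stone_Cech_map_reflects_closure[OF Tych]) (use d z[OF that] sub[OF that] top in auto)
      then show ?thesis
        using sub[OF that] by (simp add: closure_of_subtopology inf_absorb2)
    qed
    then show "\<exists>z\<in>D. \<forall>F\<in>\<F>. z \<in> X closure_of F" using d(1) by blast
  qed
  then show thesis by (rule that)
qed

lemma complete_covers_open: "complete_covers X D \<C> \<Longrightarrow> C \<in> \<C> n \<Longrightarrow> openin X C"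
  unfolding complete_covers_def by (drule conjunct1) auto

lemma complete_covers_cover: "complete_covers X D \<C> \<Longrightarrow> D \<subseteq> \<Union>(\<C> n)"
  unfolding complete_covers_def by (drule conjunct1) auto

lemma complete_covers_cluster_point:
  assumes "complete_covers X D \<C>" "\<And>F. F \<in> \<F> \<Longrightarrow> F \<subseteq> D"
    and "\<And>\<G>. \<G> \<subseteq> \<F> \<Longrightarrow> finite \<G> \<Longrightarrow> D \<inter> \<Inter>\<G> \<noteq> {}"
    and "\<And>n. \<exists>F\<in>\<F>. \<exists>U\<in>\<C> n. F \<subseteq> U"
  obtains z where "z \<in> D" "\<And>F. F \<in> \<F> \<Longrightarrow> z \<in> X closure_of F"
  using assms unfolding complete_covers_def by (metis (no_types, lifting))

lemma closure_of_coarser: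
  assumes "\<And>W. openin t W \<Longrightarrow> openin X W" "topspace t = topspace X"
  shows "X closure_of A \<subseteq> t closure_of A"
  using assms by (auto simp: in_closure_of)

text \<open>
  Baire's construction in the topology \<open>t\<close>: nonempty open sets \<open>V n\<close> with the closure of \<open>V (n + 1)\<close> inside
  \<open>V n\<close> and disjoint from the closure of the \<open>n\<close>-th set of the family, and with \<open>V (n + 1)\<close> inside a
  member of the \<open>n\<close>-th cover. The latter is achieved around a point of \<open>S\<close>, and every nonempty open
  set for \<open>t\<close> contains such points as it is open in \<open>X\<close>. The traces of the \<open>V n\<close> on \<open>D\<close> cluster in
  \<open>X\<close>, hence in the coarser topology \<open>t\<close>, at a point outside all sets of the family.
\<close>
lemma nonmeager_coarser_topology:
  assumes cc: "complete_covers X D \<C>"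
    and coarser: "\<And>W. openin t W \<Longrightarrow> openin X W" "topspace t = topspace X"
    and reg: "regular_space t"
    and S: "S \<subseteq> D" "\<And>W. openin X W \<Longrightarrow> W \<noteq> {} \<Longrightarrow> W \<inter> S \<noteq> {}"
    and small: "\<And>n x. x \<in> S \<Longrightarrow> \<exists>W. openin t W \<and> x \<in> W \<and> (\<exists>U\<in>\<C> n. W \<subseteq> U)"
    and cover: "countable \<A>" "topspace t \<subseteq> \<Union>\<A>" "topspace t \<noteq> {}"
  shows "\<exists>A\<in>\<A>. t interior_of (t closure_of A) \<noteq> {}"
proof (rule ccontr)
  assume "\<not> ?thesis"
  then have meager: "t interior_of (t closure_of A) = {}" if "A \<in> \<A>" for A using that by blast
  have ne: "\<A> \<noteq> {}" using cover(2,3) by blast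
  define A where "A = from_nat_into \<A>"
  have A: "A n \<in> \<A>" for n unfolding A_def by (rule from_nat_into[OF ne])
  have rangeA: "range A = \<A>" unfolding A_def using ne cover(1) by (rule range_from_nat_into)
  have "\<exists>V. (openin t V \<and> V \<noteq> {}) \<and> (t closure_of V \<subseteq> W - t closure_of (A n) \<and> (\<exists>U\<in>\<C> n. V \<subseteq> U))"
    if W: "openin t W \<and> W \<noteq> {}" for W n
  proof -
    let ?O = "W - t closure_of (A n)"
    have O: "openin t ?O" using W by (intro openin_diff closedin_closure_of) simp
    have "?O \<noteq> {}"
      using W meager[OF A] interior_of_maximal[of W "t closure_of (A n)" t] by auto
    then obtain x where x: "x \<in> ?O" "x \<in> S"
      using S(2)[OF coarser(1)[OF O]] by auto
    obtain V where V: "openin t V" "x \<in> V" "\<exists>U\<in>\<C> n. V \<subseteq> U"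
      using small[OF x(2), of n] by auto
    have "openin t (?O \<inter> V)" "x \<in> ?O \<inter> V" using O V x by auto
    then obtain V' where V': "openin t V'" "x \<in> V'" "t closure_of V' \<subseteq> ?O \<inter> V"
      using regular_space_shrink[OF reg] by metis
    have "V' \<subseteq> V"
      using V'(3) closure_of_subset[OF openin_subset[OF V'(1)]] by blast
    then have "\<exists>U\<in>\<C> n. V' \<subseteq> U" using V(3) by (metis subset_trans)
    moreover have "t closure_of V' \<subseteq> ?O" "V' \<noteq> {}" using V'(2,3) by auto
    ultimately show ?thesis using V'(1) by (intro exI[of _ V'] conjI)
  qed
  moreover have "\<exists>W. openin t W \<and> W \<noteq> {}"
    using openin_topspace[of t] cover(3) by blast
  ultimately have "\<exists>V. \<forall>n. (openin t (V n) \<and> V n \<noteq> {}) \<and>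
      (t closure_of (V (Suc n)) \<subseteq> V n - t closure_of (A n) \<and> (\<exists>U\<in>\<C> n. V (Suc n) \<subseteq> U))"
    by (intro dependent_nat_choice) auto
  then obtain V where V: "\<And>n. openin t (V n) \<and> V n \<noteq> {}"
    "\<And>n. t closure_of (V (Suc n)) \<subseteq> V n - t closure_of (A n) \<and> (\<exists>U\<in>\<C> n. V (Suc n) \<subseteq> U)"
    by auto
  have Vcl: "V n \<subseteq> t closure_of (V n)" for n
    by (rule closure_of_subset) (use V(1) openin_subset in blast)
  have "V (Suc n) \<subseteq> V n" for n using Vcl V(2) by blast
  then have decr: "V n \<subseteq> V m" if "m \<le> n" for m n
    using lift_Suc_antimono_le[of V] that by blast
  obtain z where z: "z \<in> D" "\<And>F. F \<in> range (\<lambda>n. V n \<inter> D) \<Longrightarrow> z \<in> X closure_of F"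
  proof (rule complete_covers_cluster_point[OF cc, of "range (\<lambda>n. V n \<inter> D)"])
    show "D \<inter> \<Inter>\<G> \<noteq> {}" if \<G>: "\<G> \<subseteq> range (\<lambda>n. V n \<inter> D)" "finite \<G>" for \<G>
    proof -
      obtain N where N: "finite N" "\<G> = (\<lambda>n. V n \<inter> D) ` N"
        using finite_subset_image[OF \<G>(2,1)] by blast
      \<comment> \<open>The maximum of the empty set would be undefined.\<close>
      define m where "m = Max (insert 0 N)"
      have "V m \<inter> S \<noteq> {}" using S(2)[of "V m"] coarser(1)[of "V m"] V(1)[of m] by simp
      then obtain x where "x \<in> V m" "x \<in> D" using S(1) by blast
      moreover have "V m \<subseteq> V n" if "n \<in> N" for n
        by (rule decr) (use that N(1) in \<open>simp add: m_def\<close>)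
      ultimately have "x \<in> D \<inter> \<Inter>\<G>" unfolding N(2) by blast
      then show ?thesis by blast
    qed
    show "\<exists>F\<in>range (\<lambda>n. V n \<inter> D). \<exists>U\<in>\<C> n. F \<subseteq> U" for n
    proof -
      obtain U where U: "U \<in> \<C> n" "V (Suc n) \<subseteq> U" using V(2)[of n] by auto
      show ?thesis
        by (rule bexI[of _ "V (Suc n) \<inter> D"], rule bexI[OF _ U(1)]) (use U(2) in auto)
    qed
  qed auto
  have "z \<in> V n - A n" for n
  proof -
    have "X closure_of (V (Suc n) \<inter> D) \<subseteq> t closure_of (V (Suc n))"
      using closure_of_coarser[OF coarser, of "V (Suc n) \<inter> D"] closure_of_mono[of "V (Suc n) \<inter> D" "V (Suc n)" t]
      by blast
    then have z': "z \<in> V n - t closure_of (A n)" using z(2) V(2)[of n] by blast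
    then have "z \<in> topspace t" using V(1)[of n] openin_subset[of t "V n"] by blast
    then have "z \<notin> A n" using z' by (auto simp: in_closure_of)
    with z' show ?thesis by blast
  qed
  then have "z \<in> V 0 - A 0" and notA: "\<And>n. z \<notin> A n" by blast+
  have "z \<in> topspace t" using \<open>z \<in> V 0 - A 0\<close> V(1)[of 0] openin_subset[of t "V 0"] by blast
  then obtain B where "B \<in> \<A>" "z \<in> B" using cover(2) by blast
  then show False using rangeA notA by blast
qed

text \<open>
  The traces on \<open>A\<close> of the closed \<open>t\<close>-neighbourhoods of \<open>x\<close> have the finite intersection property, and
  they are fine for all covers. They cluster at a point of \<open>A\<close> that lies in every \<open>t\<close>-neighbourhood of
  \<open>x\<close>: closed sets are mapped to closed sets when points not separated by \<open>t\<close> are identified.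
\<close>
lemma closure_of_coarser_saturation:
  assumes cc: "complete_covers X (topspace X) \<C>"
    and coarser: "\<And>W. openin t W \<Longrightarrow> openin X W" "topspace t = topspace X"
    and reg: "regular_space t"
    and small: "\<And>n. \<exists>W. openin t W \<and> x \<in> W \<and> (\<exists>U\<in>\<C> n. W \<subseteq> U)"
    and A: "closedin X A" "x \<in> t closure_of A"
  obtains z where "z \<in> A" "\<And>W. openin t W \<Longrightarrow> x \<in> W \<Longrightarrow> z \<in> W"
proof -
  define \<V> where "\<V> = {V. closedin t V \<and> x \<in> t interior_of V}"
  have xt: "x \<in> topspace t" using A(2) by (simp add: in_closure_of)
  have shrink: "\<exists>V\<in>\<V>. V \<subseteq> W" if W: "openin t W" "x \<in> W" for W
  proof -
    obtain V where V: "openin t V" "x \<in> V" "t closure_of V \<subseteq> W"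
      using regular_space_shrink[OF reg W] by metis
    have "V \<subseteq> t interior_of (t closure_of V)"
      by (intro interior_of_maximal closure_of_subset openin_subset V(1))
    then have "t closure_of V \<in> \<V>" using V(2) by (auto simp: \<V>_def)
    then show ?thesis using V(3) by blast
  qed
  have topA: "A \<subseteq> topspace X" using A(1) by (rule closedin_subset)
  obtain z where z: "z \<in> topspace X" "\<And>F. F \<in> (\<lambda>V. A \<inter> V) ` \<V> \<Longrightarrow> z \<in> X closure_of F"
  proof (rule complete_covers_cluster_point[OF cc, of "(\<lambda>V. A \<inter> V) ` \<V>"])
    show "F \<subseteq> topspace X" if "F \<in> (\<lambda>V. A \<inter> V) ` \<V>" for F using that topA by blast
    show "topspace X \<inter> \<Inter>\<G> \<noteq> {}" if \<G>: "\<G> \<subseteq> (\<lambda>V. A \<inter> V) ` \<V>" "finite \<G>" for \<G>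
    proof -
      obtain \<W> where \<W>: "\<W> \<subseteq> \<V>" "finite \<W>" "\<G> = (\<lambda>V. A \<inter> V) ` \<W>"
        using finite_subset_image[OF \<G>(2,1)] by blast
      have "openin t ((\<Inter>V\<in>\<W>. t interior_of V) \<inter> topspace t)"
        by (rule openin_INT[OF \<W>(2)]) simp
      moreover have "x \<in> (\<Inter>V\<in>\<W>. t interior_of V) \<inter> topspace t"
        using \<W>(1) xt by (auto simp: \<V>_def)
      ultimately obtain y where y: "y \<in> A" "y \<in> (\<Inter>V\<in>\<W>. t interior_of V)"
        using A(2) unfolding in_closure_of by blast
      have "y \<in> A \<inter> V" if "V \<in> \<W>" for V
        using y that interior_of_subset[of t V] by blast
      then show ?thesis using y(1) topA \<W>(3) by blast
    qed
    show "\<exists>F\<in>(\<lambda>V. A \<inter> V) ` \<V>. \<exists>U\<in>\<C> n. F \<subseteq> U" for n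
    proof -
      obtain W U where W: "openin t W" "x \<in> W" and U: "U \<in> \<C> n" "W \<subseteq> U"
        using small[of n] by auto
      obtain V where V: "V \<in> \<V>" "V \<subseteq> W" using shrink[OF W] by auto
      show ?thesis
        by (rule bexI[of _ "A \<inter> V"], rule bexI[OF _ U(1)]) (use U(2) V in auto)
    qed
  qed auto
  obtain V0 where V0: "V0 \<in> \<V>" using shrink[OF openin_topspace xt] by blast
  have cl: "z \<in> A \<inter> V" if "V \<in> \<V>" for V
  proof -
    have "closedin X V"
      using that coarser unfolding \<V>_def closedin_def by auto
    then have "closedin X (A \<inter> V)" using A(1) by blast
    then have "X closure_of (A \<inter> V) = A \<inter> V" by (rule closure_of_closedin)
    then show ?thesis using z(2)[of "A \<inter> V"] that by auto
  qed
  show thesis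
  proof
    show "z \<in> A" using cl[OF V0] by blast
    show "z \<in> W" if W: "openin t W" "x \<in> W" for W
    proof -
      obtain V where V: "V \<in> \<V>" "V \<subseteq> W" using shrink[OF W] by auto
      then show ?thesis using cl[OF V(1)] by blast
    qed
  qed
qed

section \<open>Transitive actions of narrow groups\<close>

locale narrow_action =
  fixes G :: "('g, 'm) monoid_scheme" (structure) and T :: "'g topology"
    and X :: "'a topology" and \<theta> :: "'g \<Rightarrow> 'a \<Rightarrow> 'a"
  assumes topgroup: "topological_group G T" and narrow: "omega_narrow G T"
    and Tych: "Tychonoff_space X"
    and transitive: "transitive_action G (topspace X) \<theta>"
    and continuous: "continuous_map (prod_topology T X) X (\<lambda>(g, x). \<theta> g x)"
begin

sublocale group G
  using topgroup by (simp add: topological_group_def)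

sublocale transitive_action G "topspace X" \<theta>
  by (rule transitive)

definition nbhd :: "'g set \<Rightarrow> bool"
  where "nbhd U \<longleftrightarrow> openin T U \<and> \<one> \<in> U"

definition orb :: "'g set \<Rightarrow> 'a \<Rightarrow> 'a set"
  where "orb U x = (\<lambda>g. \<theta> g x) ` U"

lemma topspace_T: "topspace T = carrier G"
  using topgroup by (simp add: topological_group_def)

lemma nbhd_carrier: "nbhd U \<Longrightarrow> U \<subseteq> carrier G"
  using openin_subset[of T U] by (auto simp: nbhd_def topspace_T)

lemma nbhd_in_carrier: "nbhd U \<Longrightarrow> u \<in> U \<Longrightarrow> u \<in> carrier G"
  using nbhd_carrier by blast

lemma act_in: "g \<in> carrier G \<Longrightarrow> x \<in> topspace X \<Longrightarrow> \<theta> g x \<in> topspace X"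
  using element_image by blast

lemma act_one: "x \<in> topspace X \<Longrightarrow> \<theta> \<one> x = x"
  using id_eq_one by (metis restrict_apply')

lemma act_mult: "g \<in> carrier G \<Longrightarrow> h \<in> carrier G \<Longrightarrow> x \<in> topspace X \<Longrightarrow> \<theta> (g \<otimes> h) x = \<theta> g (\<theta> h x)"
  by (rule composition_rule)

lemma act_inv: "g \<in> carrier G \<Longrightarrow> x \<in> topspace X \<Longrightarrow> \<theta> (inv g) (\<theta> g x) = x"
  by (metis act_mult act_one inv_closed l_inv)

lemma orb_subset: "U \<subseteq> carrier G \<Longrightarrow> x \<in> topspace X \<Longrightarrow> orb U x \<subseteq> topspace X"
  using act_in by (auto simp: orb_def)

lemma orb_mono: "U \<subseteq> V \<Longrightarrow> orb U x \<subseteq> orb V x"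
  by (auto simp: orb_def)

lemma translate_orb:
  assumes "g \<in> carrier G" "U \<subseteq> carrier G" "x \<in> topspace X"
  shows "\<theta> g ` orb U x = orb ((\<lambda>u. g \<otimes> u) ` U) x"
  using assms by (auto simp: orb_def image_image act_mult subsetD intro!: image_cong)

lemma continuous_map_act:
  assumes "g \<in> carrier G" shows "continuous_map X X (\<theta> g)"
proof -
  have "continuous_map X (prod_topology T X) (\<lambda>x. (g, x))"
    using assms by (simp add: continuous_map_pairedI topspace_T)
  then have "continuous_map X X ((\<lambda>(g, x). \<theta> g x) \<circ> (\<lambda>x. (g, x)))"
    by (rule continuous_map_compose[OF _ continuous])
  then show ?thesis by (simp add: o_def)
qed

lemma regular: "regular_space X"
  using Tych by (simp add: Tychonoff_space_def completely_regular_imp_regular_space)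

lemma act_nbhd:
  assumes "openin X W" "x \<in> W"
  obtains U P where "nbhd U" "openin X P" "x \<in> P" "\<And>u y. u \<in> U \<Longrightarrow> y \<in> P \<Longrightarrow> \<theta> u y \<in> W"
proof -
  have x: "x \<in> topspace X" using assms openin_subset by blast
  let ?M = "{z \<in> topspace (prod_topology T X). (\<lambda>(g, x). \<theta> g x) z \<in> W}"
  have "openin (prod_topology T X) ?M"
    by (rule openin_continuous_map_preimage[OF continuous assms(1)])
  moreover have "(\<one>, x) \<in> ?M"
    using x assms(2) by (simp add: topspace_T act_one)
  ultimately have "\<exists>U P. openin T U \<and> openin X P \<and> \<one> \<in> U \<and> x \<in> P \<and> U \<times> P \<subseteq> ?M"
    unfolding openin_prod_topology_alt by simp
  then obtain U P where UP: "openin T U" "openin X P" "\<one> \<in> U" "x \<in> P" "U \<times> P \<subseteq> ?M" by blast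
  show thesis
  proof
    show "nbhd U" using UP by (simp add: nbhd_def)
    show "\<theta> u y \<in> W" if "u \<in> U" "y \<in> P" for u y
      using UP(5) that by auto
  qed (use UP in auto)
qed

lemma nbhd_mult:
  assumes "nbhd U"
  obtains V where "nbhd V" "V \<subseteq> U" "\<And>a b. a \<in> V \<Longrightarrow> b \<in> V \<Longrightarrow> a \<otimes> b \<in> U"
proof -
  have mult: "continuous_map (prod_topology T T) T (\<lambda>(g, h). g \<otimes> h)"
    using topgroup by (simp add: topological_group_def)
  let ?M = "{z \<in> topspace (prod_topology T T). (\<lambda>(g, h). g \<otimes> h) z \<in> U}"
  have "openin (prod_topology T T) ?M"
    by (rule openin_continuous_map_preimage[OF mult]) (use assms in \<open>simp add: nbhd_def\<close>)
  moreover have "(\<one>, \<one>) \<in> ?M"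
    using assms by (simp add: topspace_T nbhd_def)
  ultimately have "\<exists>V V'. openin T V \<and> openin T V' \<and> \<one> \<in> V \<and> \<one> \<in> V' \<and> V \<times> V' \<subseteq> ?M"
    unfolding openin_prod_topology_alt by simp
  then obtain V V' where V: "openin T V" "openin T V'" "\<one> \<in> V" "\<one> \<in> V'" "V \<times> V' \<subseteq> ?M" by blast
  show thesis
  proof
    show "nbhd (V \<inter> V' \<inter> U)" using V assms by (auto simp: nbhd_def)
    show "a \<otimes> b \<in> U" if "a \<in> V \<inter> V' \<inter> U" "b \<in> V \<inter> V' \<inter> U" for a b
      using V(5) that by auto
  qed auto
qed

lemma nbhd_symmetric_cube:
  assumes "nbhd U"
  obtains V where "nbhd V" "\<And>v. v \<in> V \<Longrightarrow> inv v \<in> V"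
    "\<And>a b c. a \<in> V \<Longrightarrow> b \<in> V \<Longrightarrow> c \<in> V \<Longrightarrow> a \<otimes> b \<otimes> c \<in> U"
proof -
  obtain V1 where V1: "nbhd V1" "V1 \<subseteq> U" "\<And>a b. a \<in> V1 \<Longrightarrow> b \<in> V1 \<Longrightarrow> a \<otimes> b \<in> U"
    using nbhd_mult[OF assms] by metis
  obtain V2 where V2: "nbhd V2" "V2 \<subseteq> V1" "\<And>a b. a \<in> V2 \<Longrightarrow> b \<in> V2 \<Longrightarrow> a \<otimes> b \<in> V1"
    using nbhd_mult[OF V1(1)] by metis
  define V where "V = V2 \<inter> {g \<in> topspace T. inv g \<in> V2}"
  have "continuous_map T T (\<lambda>g. inv g)"
    using topgroup by (simp add: topological_group_def)
  then have "openin T {g \<in> topspace T. inv g \<in> V2}"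
    by (rule openin_continuous_map_preimage) (use V2(1) in \<open>simp add: nbhd_def\<close>)
  then have "nbhd V"
    using V2(1) by (auto simp: V_def nbhd_def topspace_T)
  moreover have "inv v \<in> V" if "v \<in> V" for v
    using that nbhd_carrier[OF V2(1)] by (auto simp: V_def topspace_T)
  moreover have "a \<otimes> b \<otimes> c \<in> U" if "a \<in> V" "b \<in> V" "c \<in> V" for a b c
    using that V1(3) V2(2,3) by (auto simp: V_def)
  ultimately show thesis by (rule that)
qed

lemma narrow_countable:
  assumes "nbhd U"
  obtains A where "countable A" "A \<subseteq> carrier G"
    "\<And>g. g \<in> carrier G \<Longrightarrow> \<exists>u\<in>U. \<exists>a\<in>A. g = u \<otimes> a"
    "\<And>g. g \<in> carrier G \<Longrightarrow> \<exists>u\<in>U. \<exists>a\<in>A. g = a \<otimes> u"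
proof -
  have "U \<subseteq> carrier G \<and> \<one> \<in> T interior_of U"
    using assms nbhd_carrier by (auto simp: nbhd_def interior_of_openin)
  then obtain A where A: "countable A" "A \<subseteq> carrier G" "U <#> A = carrier G" "A <#> U = carrier G"
    using narrow unfolding omega_narrow_def by auto
  show thesis
  proof
    show "\<exists>u\<in>U. \<exists>a\<in>A. g = u \<otimes> a" if "g \<in> carrier G" for g
      using that A(3) unfolding set_mult_def by blast
    show "\<exists>u\<in>U. \<exists>a\<in>A. g = a \<otimes> u" if "g \<in> carrier G" for g
      using that A(4) unfolding set_mult_def by blast
  qed (use A in auto)
qed

text \<open>
  For a symmetric \<open>V\<close> with \<open>V V \<subseteq> U\<close>, narrowness gives countably many translates \<open>a V x\<close> that cover
  the space, so the closure of one of them contains a nonempty open set \<open>W\<close>. Now \<open>W\<close> meets \<open>a V x\<close> in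
  some \<open>a v x\<close>, and the homeomorphism \<open>(a v)\<^sup>-\<^sup>1\<close> takes \<open>W\<close> to a neighbourhood of \<open>x\<close> in the closure of
  \<open>v\<^sup>-\<^sup>1 V x \<subseteq> U x\<close>.
\<close>
lemma orb_closure_nbhd:
  assumes top: "topspace t = topspace X"
    and act: "\<And>g. g \<in> carrier G \<Longrightarrow> continuous_map t t (\<theta> g)"
    and nonmeager: "\<And>\<A>. countable \<A> \<Longrightarrow> topspace t \<subseteq> \<Union>\<A> \<Longrightarrow> \<exists>A\<in>\<A>. t interior_of (t closure_of A) \<noteq> {}"
    and U: "nbhd U" and x: "x \<in> topspace X"
  shows "x \<in> t interior_of (t closure_of (orb U x))"
proof -
  obtain V where V: "nbhd V" "\<And>v. v \<in> V \<Longrightarrow> inv v \<in> V"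
    "\<And>a b c. a \<in> V \<Longrightarrow> b \<in> V \<Longrightarrow> c \<in> V \<Longrightarrow> a \<otimes> b \<otimes> c \<in> U"
    using nbhd_symmetric_cube[OF U] by metis
  have VG: "v \<in> carrier G" if "v \<in> V" for v using that nbhd_carrier[OF V(1)] by blast
  obtain A where A: "countable A" "A \<subseteq> carrier G" "\<And>g. g \<in> carrier G \<Longrightarrow> \<exists>u\<in>V. \<exists>a\<in>A. g = a \<otimes> u"
    using narrow_countable[OF V(1)] by metis
  have "topspace t \<subseteq> \<Union>((\<lambda>a. \<theta> a ` orb V x) ` A)"
  proof
    fix y assume "y \<in> topspace t"
    then obtain g where g: "g \<in> carrier G" "\<theta> g x = y"
      using unique_orbit[OF x, of y] top by auto
    obtain u a where ua: "u \<in> V" "a \<in> A" "g = a \<otimes> u" using A(3)[OF g(1)] by auto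
    then have "y = \<theta> a (\<theta> u x)"
      using g(2) act_mult[of a u x] A(2) VG x by auto
    then show "y \<in> \<Union>((\<lambda>a. \<theta> a ` orb V x) ` A)"
      using ua by (auto simp: orb_def)
  qed
  then obtain a where a: "a \<in> A" "t interior_of (t closure_of (\<theta> a ` orb V x)) \<noteq> {}"
    using nonmeager[of "(\<lambda>a. \<theta> a ` orb V x) ` A"] A(1) by auto
  define W where "W = t interior_of (t closure_of (\<theta> a ` orb V x))"
  have W: "openin t W" "W \<subseteq> t closure_of (\<theta> a ` orb V x)" "W \<noteq> {}"
    using a(2) by (auto simp: W_def interior_of_subset)
  then obtain y where "y \<in> W" "y \<in> \<theta> a ` orb V x"
    unfolding in_closure_of subset_iff by blast
  then obtain v where v: "v \<in> V" "\<theta> a (\<theta> v x) \<in> W" by (auto simp: orb_def)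
  have aG: "a \<in> carrier G" and vG: "v \<in> carrier G" using a(1) A(2) v(1) VG by auto
  define h where "h = inv v \<otimes> inv a"
  have hG: "h \<in> carrier G" using aG vG by (simp add: h_def)
  have h: "\<theta> h (\<theta> a (\<theta> v y)) = y" if "y \<in> topspace X" for y
    using that aG vG by (simp add: h_def act_mult act_in act_inv)
  have avG: "a \<otimes> v \<in> carrier G" using aG vG by simp
  have cont: "continuous_map t t (\<lambda>y. \<theta> a (\<theta> v y))"
    using continuous_map_compose[OF act[OF vG] act[OF aG]] by (simp add: o_def)
  define O' where "O' = {y \<in> topspace t. \<theta> a (\<theta> v y) \<in> W}"
  have "openin t O'" unfolding O'_def by (rule openin_continuous_map_preimage[OF cont W(1)])
  moreover have "x \<in> O'" using x v(2) top by (simp add: O'_def)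
  moreover have "O' \<subseteq> t closure_of (orb U x)"
  proof
    fix y assume "y \<in> O'"
    then have y: "y \<in> topspace X" "\<theta> a (\<theta> v y) \<in> t closure_of (\<theta> a ` orb V x)"
      using W(2) top by (auto simp: O'_def)
    have "\<theta> h ` (t closure_of (\<theta> a ` orb V x)) \<subseteq> t closure_of (\<theta> h ` \<theta> a ` orb V x)"
      by (rule continuous_map_image_closure_subset[OF act[OF hG]])
    then have "y \<in> t closure_of (\<theta> h ` \<theta> a ` orb V x)"
      using y h by (metis image_eqI subsetD)
    moreover have "\<theta> h ` \<theta> a ` orb V x \<subseteq> orb U x"
    proof -
      have "\<theta> h (\<theta> a (\<theta> w x)) \<in> orb U x" if w: "w \<in> V" for w
      proof -
        have "\<theta> h (\<theta> a (\<theta> w x)) = \<theta> (inv v \<otimes> w \<otimes> \<one>) x"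
          using aG vG VG[OF w] x by (simp add: h_def act_mult act_in act_inv)
        moreover have "inv v \<otimes> w \<otimes> \<one> \<in> U"
          by (rule V(3)) (use v w V(1,2) in \<open>auto simp: nbhd_def\<close>)
        ultimately show ?thesis by (auto simp: orb_def)
      qed
      then show ?thesis by (auto simp: orb_def)
    qed
    ultimately show "y \<in> t closure_of (orb U x)"
      using closure_of_mono by blast
  qed
  ultimately show ?thesis
    using interior_of_maximal by blast
qed

text \<open>
  A set that contains all translates of its members is uncountable in general. Continuity of the
  translates for the initial topology of \<open>F\<close> is compatible with countability, and it suffices to
  let the group act on the quotient by homeomorphisms.
\<close>
definition invariant_family :: "('a \<Rightarrow> real) set \<Rightarrow> bool"
  where "invariant_family F \<longleftrightarrow> (\<forall>f\<in>F. continuous_map X euclideanreal f \<and>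
    (\<forall>g\<in>carrier G. continuous_map (initial_topology (topspace X) F) euclideanreal (\<lambda>x. f (\<theta> g x))))"

lemma invariant_family_Union:
  assumes "\<forall>F\<in>\<F>. invariant_family F" shows "invariant_family (\<Union>\<F>)"
  unfolding invariant_family_def
proof (intro ballI conjI)
  let ?t = "initial_topology (topspace X)"
  fix f assume "f \<in> \<Union>\<F>"
  then obtain F where F: "F \<in> \<F>" "f \<in> F" by blast
  then have "invariant_family F" using assms by blast
  then show "continuous_map X euclideanreal f" using F(2) by (simp add: invariant_family_def)
  fix g assume "g \<in> carrier G"
  then have f: "continuous_map (?t F) euclideanreal (\<lambda>x. f (\<theta> g x))"
    using \<open>invariant_family F\<close> F(2) by (simp add: invariant_family_def)
  have "continuous_map (?t (\<Union>\<F>)) (?t F) (\<lambda>x. x)"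
    by (rule continuous_map_into_initial) (use F(1) continuous_map_initial_member[of _ "\<Union>\<F>"] in auto)
  from continuous_map_compose[OF this f]
  show "continuous_map (?t (\<Union>\<F>)) euclideanreal (\<lambda>x. f (\<theta> g x))" by (simp add: o_def)
qed

lemma invariant_family_continuous_map_act:
  assumes "invariant_family F" "g \<in> carrier G"
  shows "continuous_map (initial_topology (topspace X) F) (initial_topology (topspace X) F) (\<theta> g)"
  by (rule continuous_map_into_initial) (use assms act_in in \<open>auto simp: invariant_family_def\<close>)

end

section \<open>Dense orbits and gauges on the space\<close>

lemma continuous_map_realI:
  assumes "\<And>x \<epsilon>. x \<in> topspace X \<Longrightarrow> \<epsilon> > 0 \<Longrightarrow>
    \<exists>U. openin X U \<and> x \<in> U \<and> (\<forall>y\<in>U. \<bar>f y - f x\<bar> < (\<epsilon>::real))"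
  shows "continuous_map X euclideanreal f"
  unfolding continuous_map_def
proof (intro conjI allI impI)
  fix S :: "real set" assume "openin euclideanreal S"
  then have S: "open S" by simp
  show "openin X {x \<in> topspace X. f x \<in> S}"
  proof (subst openin_subopen, intro ballI)
    fix x assume x: "x \<in> {x \<in> topspace X. f x \<in> S}"
    then obtain \<epsilon> where \<epsilon>: "\<epsilon> > 0" "\<And>y. dist y (f x) < \<epsilon> \<Longrightarrow> y \<in> S"
      using S unfolding open_dist by auto
    obtain U where U: "openin X U" "x \<in> U" "\<forall>y\<in>U. \<bar>f y - f x\<bar> < \<epsilon>"
      using assms[of x \<epsilon>] x \<epsilon>(1) by auto
    have "U \<subseteq> {x \<in> topspace X. f x \<in> S}"
      using U openin_subset[OF U(1)] \<epsilon>(2) by (auto simp: dist_real_def)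
    then show "\<exists>T. openin X T \<and> x \<in> T \<and> T \<subseteq> {x \<in> topspace X. f x \<in> S}"
      using U(1,2) by blast
  qed
qed simp

lemma continuous_map_real_ball:
  assumes "continuous_map X euclideanreal f" "x \<in> topspace X" "(\<epsilon>::real) > 0"
  obtains U where "openin X U" "x \<in> U" "\<And>y. y \<in> U \<Longrightarrow> \<bar>f y - f x\<bar> < \<epsilon>"
proof
  show "openin X {y \<in> topspace X. f y \<in> ball (f x) \<epsilon>}"
    by (rule openin_continuous_map_preimage[OF assms(1)]) simp
qed (use assms in \<open>auto simp: dist_real_def\<close>)

lemma continuous_map_real_approx:
  assumes "\<And>\<epsilon>. \<epsilon> > 0 \<Longrightarrow> \<exists>h. continuous_map X euclideanreal h \<and> (\<forall>x\<in>topspace X. \<bar>k x - h x\<bar> < (\<epsilon>::real))"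
  shows "continuous_map X euclideanreal k"
proof (rule continuous_map_realI)
  fix x and \<epsilon> :: real assume x: "x \<in> topspace X" and \<epsilon>: "\<epsilon> > 0"
  obtain h where h: "continuous_map X euclideanreal h" "\<And>y. y \<in> topspace X \<Longrightarrow> \<bar>k y - h y\<bar> < \<epsilon>/3"
    using assms[of "\<epsilon>/3"] \<epsilon> by auto
  obtain U where U: "openin X U" "x \<in> U" "\<And>y. y \<in> U \<Longrightarrow> \<bar>h y - h x\<bar> < \<epsilon>/3"
    using continuous_map_real_ball[OF h(1) x, of "\<epsilon>/3"] \<epsilon> by auto
  have "\<bar>k y - k x\<bar> < \<epsilon>" if y: "y \<in> U" for y
  proof -
    have "y \<in> topspace X" using openin_subset[OF U(1)] y by blast
    then show ?thesis using h(2)[of y] h(2)[OF x] U(3)[OF y] by linarith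
  qed
  then show "\<exists>U. openin X U \<and> x \<in> U \<and> (\<forall>y\<in>U. \<bar>k y - k x\<bar> < \<epsilon>)"
    using U(1,2) by blast
qed

definition weight :: "nat list \<Rightarrow> real"
  where "weight ns = (\<Sum>n\<leftarrow>ns. (1/2) ^ n)"

lemma weight_simps [simp]: "weight [] = 0" "weight (n # ns) = (1/2) ^ n + weight ns"
  by (simp_all add: weight_def)

lemma weight_append [simp]: "weight (xs @ ys) = weight xs + weight ys"
  by (simp add: weight_def)

lemma weight_nonneg: "0 \<le> weight ns"
  unfolding weight_def by (rule sum_list_nonneg) auto

text \<open>
  The element \<open>y\<close> at which the partial sums reach \<open>c\<close> leaves a part of weight below \<open>c\<close> on either
  side. The number \<open>d\<close> is the weight of the elements already passed in the induction.
\<close>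
lemma split_weight:
  assumes "ns \<noteq> []" "d + weight ns < 2 * c" "d < c" "0 \<le> d"
  shows "\<exists>xs y zs. ns = xs @ y # zs \<and> d + weight xs < c \<and> weight zs < c"
  using assms
proof (induction ns arbitrary: d)
  case (Cons n ns)
  show ?case
  proof (cases "weight ns < c")
    case True
    then show ?thesis using Cons.prems(3) by (intro exI[of _ "[]"]) simp
  next
    case False
    have "ns \<noteq> []" using False Cons.prems(3,4) by auto
    moreover have "d + (1/2) ^ n < c" using Cons.prems(2) False by simp
    ultimately obtain xs y zs where "ns = xs @ y # zs" "(d + (1/2) ^ n) + weight xs < c" "weight zs < c"
      using Cons.IH[of "d + (1/2) ^ n"] Cons.prems(2,4) by (auto simp: add.assoc)
    then show ?thesis by (intro exI[of _ "n # xs"]) (auto simp: add.assoc)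
  qed
qed simp

text \<open>
  The sets \<open>U x\<close> need not be neighbourhoods of \<open>x\<close>; their closures take this role. As \<open>U\<close> varies,
  the relations \<open>z \<in> closure (U y)\<close> behave like the entourages of a uniformity on \<open>X\<close>.
\<close>
locale dense_orbit_action = narrow_action G T X \<theta>
  for G :: "('g, 'm) monoid_scheme" (structure) and T :: "'g topology"
    and X :: "'a topology" and \<theta> :: "'g \<Rightarrow> 'a \<Rightarrow> 'a" +
  assumes orb_closure: "nbhd U \<Longrightarrow> x \<in> topspace X \<Longrightarrow> x \<in> X interior_of (X closure_of (orb U x))"
begin

lemma act_closure:
  assumes "g \<in> carrier G" "y \<in> X closure_of A"
  shows "\<theta> g y \<in> X closure_of (\<theta> g ` A)"
  using continuous_map_image_closure_subset[OF continuous_map_act[OF assms(1)], of A] assms(2) by blast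

text \<open>
  The neighbourhood of \<open>z\<close> in which \<open>V z\<close> is dense meets \<open>V y\<close> in some \<open>v y\<close>; translate by the
  inverse of \<open>v\<close>.
\<close>
lemma closure_orb_symmetric:
  assumes V: "nbhd V" "\<And>a b. a \<in> V \<Longrightarrow> b \<in> V \<Longrightarrow> inv a \<otimes> b \<in> U"
    and y: "y \<in> topspace X" "z \<in> X closure_of (orb V y)"
  shows "y \<in> X closure_of (orb U z)"
proof -
  have z: "z \<in> topspace X" using y(2) by (simp add: in_closure_of)
  have "z \<in> X interior_of (X closure_of (orb V z))" by (rule orb_closure[OF V(1) z])
  moreover have "\<forall>S. z \<in> S \<and> openin X S \<longrightarrow> (\<exists>w. w \<in> orb V y \<and> w \<in> S)"
    using y(2) unfolding in_closure_of[of z] by (rule conjunct2)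
  ultimately have "\<exists>w. w \<in> orb V y \<and> w \<in> X interior_of (X closure_of (orb V z))"
    using openin_interior_of[of X "X closure_of (orb V z)"] by simp
  then obtain w where w: "w \<in> orb V y" "w \<in> X interior_of (X closure_of (orb V z))" by auto
  then obtain v where v: "v \<in> V" "w = \<theta> v y" by (auto simp: orb_def)
  have vG: "v \<in> carrier G" using nbhd_in_carrier[OF V(1) v(1)] .
  have "\<theta> v y \<in> X closure_of (orb V z)" using in_interior_of_imp[OF w(2)] v(2) by simp
  then have "\<theta> (inv v) (\<theta> v y) \<in> X closure_of (\<theta> (inv v) ` orb V z)"
    using act_closure[OF inv_closed[OF vG]] by simp
  moreover have "\<theta> (inv v) ` orb V z \<subseteq> orb U z"
    unfolding translate_orb[OF inv_closed[OF vG] nbhd_carrier[OF V(1)] z]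
    by (rule orb_mono) (use V(2)[OF v(1)] in auto)
  ultimately show ?thesis
    using act_inv[OF vG y(1)] by (metis in_closure_of_mono)
qed

end

text \<open>
  The sequence starts with the whole group, so that by transitivity every point can be reached from every other
  by a product of members of the sequence.
\<close>
locale gauge_sequence = dense_orbit_action G T X \<theta>
  for G :: "('g, 'm) monoid_scheme" (structure) and T :: "'g topology"
    and X :: "'a topology" and \<theta> :: "'g \<Rightarrow> 'a \<Rightarrow> 'a" +
  fixes U :: "nat \<Rightarrow> 'g set"
  assumes U_zero: "U 0 = carrier G"
    and U_nbhd: "nbhd (U n)"
    and U_inv: "v \<in> U n \<Longrightarrow> inv v \<in> U n"
    and U_cube: "a \<in> U (Suc n) \<Longrightarrow> b \<in> U (Suc n) \<Longrightarrow> c \<in> U (Suc n) \<Longrightarrow> a \<otimes> b \<otimes> c \<in> U n"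
begin

primrec prods :: "nat list \<Rightarrow> 'g set"
  where "prods [] = {\<one>}" | "prods (n # ns) = U n <#> prods ns"

lemma one_in_U: "\<one> \<in> U n"
  using U_nbhd by (simp add: nbhd_def)

lemma U_carrier: "U n \<subseteq> carrier G"
  by (rule nbhd_carrier[OF U_nbhd])

lemma prods_carrier: "prods ns \<subseteq> carrier G"
  by (induction ns) (simp_all add: set_mult_closed U_carrier)

lemma prods_append: "prods (xs @ ys) = prods xs <#> prods ys"
proof (induction xs)
  case Nil
  have "{\<one>} <#> prods ys = prods ys"
    using prods_carrier[of ys] by (force simp: set_mult_def)
  then show ?case by simp
next
  case (Cons n xs)
  then show ?case by (simp add: set_mult_assoc U_carrier prods_carrier)
qed

lemma U_Suc: "U (Suc n) \<subseteq> U n"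
proof
  fix u assume u: "u \<in> U (Suc n)"
  then have "u \<otimes> \<one> \<otimes> \<one> \<in> U n" by (intro U_cube one_in_U)
  moreover have "u \<in> carrier G" using u U_carrier by blast
  ultimately show "u \<in> U n" by simp
qed

lemma U_antimono: "m \<le> n \<Longrightarrow> U n \<subseteq> U m"
  by (rule lift_Suc_antimono_le[of U, OF U_Suc])

text \<open>
  The chain argument of Birkhoff and Kakutani: a list of weight below \<open>2\<^sup>-\<^sup>m\<close> splits into a single element and
  two lists of weight below half of that, and the cube of \<open>U (m + 1)\<close> is inside \<open>U m\<close>.
\<close>
lemma prods_small:
  assumes "weight ns < (1/2) ^ m" shows "prods ns \<subseteq> U m"
  using assms
proof (induction "length ns" arbitrary: ns m rule: less_induct)
  case less
  show ?case
  proof (cases "ns = []")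
    case True
    then show ?thesis using one_in_U by simp
  next
    case False
    have "\<exists>xs y zs. ns = xs @ y # zs \<and> 0 + weight xs < (1/2) ^ Suc m \<and> weight zs < (1/2) ^ Suc m"
      by (rule split_weight) (use False less.prems in auto)
    then obtain xs y zs where ns: "ns = xs @ y # zs" "weight xs < (1/2) ^ Suc m" "weight zs < (1/2) ^ Suc m"
      by auto
    have "(1/2) ^ y < (1/2 :: real) ^ m"
      using less.prems weight_nonneg[of xs] weight_nonneg[of zs] unfolding ns(1) weight_append weight_simps
      by linarith
    then have "Suc m \<le> y"
      using power_decreasing[of y m "1/2 :: real"] by (cases "y \<le> m") auto
    then have "U y \<subseteq> U (Suc m)" by (rule U_antimono)
    moreover have "prods xs \<subseteq> U (Suc m)" "prods zs \<subseteq> U (Suc m)"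
      using less.hyps ns by auto
    ultimately have "a \<otimes> (b \<otimes> c) \<in> U m" if "a \<in> prods xs" "b \<in> U y" "c \<in> prods zs" for a b c
    proof -
      have abc: "a \<in> U (Suc m)" "b \<in> U (Suc m)" "c \<in> U (Suc m)"
        using that \<open>U y \<subseteq> U (Suc m)\<close> \<open>prods xs \<subseteq> U (Suc m)\<close> \<open>prods zs \<subseteq> U (Suc m)\<close> by auto
      then have "a \<in> carrier G" "b \<in> carrier G" "c \<in> carrier G" using U_carrier by auto
      then show ?thesis using U_cube[OF abc] by (simp add: m_assoc)
    qed
    then show ?thesis
      unfolding ns(1) prods_append by (auto simp: set_mult_def)
  qed
qed

text \<open>
  A one-sided distance from \<open>p\<close>: the infimum of the weights of the products of members of the sequence that move
  \<open>p\<close> arbitrarily close to \<open>y\<close>.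
\<close>
definition orbit_gauge :: "'a \<Rightarrow> 'a \<Rightarrow> real"
  where "orbit_gauge p y = Inf (weight ` {ns. y \<in> X closure_of (orb (prods ns) p)})"

lemma gauge_le:
  assumes "y \<in> X closure_of (orb (prods ns) p)" shows "orbit_gauge p y \<le> weight ns"
  unfolding orbit_gauge_def
  by (rule cInf_lower) (use assms weight_nonneg in \<open>auto intro!: bdd_belowI[of _ 0]\<close>)

lemma gauge_less_imp:
  assumes p: "p \<in> topspace X" and y: "y \<in> topspace X" and c: "orbit_gauge p y < c"
  obtains ns where "y \<in> X closure_of (orb (prods ns) p)" "weight ns < c"
proof -
  have "carrier G <#> {\<one>} = carrier G"
    by (force simp: set_mult_def)
  then have all: "prods [0] = carrier G" by (simp add: U_zero)
  obtain g where "g \<in> carrier G" "\<theta> g p = y" using unique_orbit[OF p y] by blast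
  then have "y \<in> orb (prods [0]) p" unfolding all by (auto simp: orb_def)
  then have "y \<in> X closure_of (orb (prods [0]) p)"
    by (rule in_closure_of_self[OF _ orb_subset[OF prods_carrier p]])
  then have "weight ` {ns. y \<in> X closure_of (orb (prods ns) p)} \<noteq> {}" by blast
  from cInf_lessD[OF this c[unfolded orbit_gauge_def]] show thesis using that by blast
qed

lemma gauge_less_power:
  assumes "p \<in> topspace X" "y \<in> topspace X" "orbit_gauge p y < (1/2) ^ m"
  shows "y \<in> X closure_of (orb (U m) p)"
proof -
  obtain ns where "y \<in> X closure_of (orb (prods ns) p)" "weight ns < (1/2) ^ m"
    using gauge_less_imp[OF assms] .
  then show ?thesis using in_closure_of_mono[OF _ orb_mono[OF prods_small]] by simp
qed

text \<open>
  A product that moves \<open>p\<close> close to \<open>y\<close> is extended on the left by \<open>U n\<close>, at the cost of \<open>2\<^sup>-\<^sup>n\<close>.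
\<close>
lemma gauge_closure_orb:
  assumes p: "p \<in> topspace X" and y: "y \<in> topspace X" and z: "z \<in> X closure_of (orb (U n) y)"
  shows "orbit_gauge p z \<le> orbit_gauge p y + (1/2) ^ n"
proof (rule field_le_epsilon)
  fix e :: real assume "0 < e"
  then have "orbit_gauge p y < orbit_gauge p y + e" by simp
  then obtain ns where ns: "y \<in> X closure_of (orb (prods ns) p)" "weight ns < orbit_gauge p y + e"
    using gauge_less_imp[OF p y] by metis
  have "orb (U n) y \<subseteq> X closure_of (orb (prods (n # ns)) p)"
  proof
    fix w assume "w \<in> orb (U n) y"
    then obtain u where u: "u \<in> U n" "w = \<theta> u y" by (auto simp: orb_def)
    then have uG: "u \<in> carrier G" using U_carrier by blast
    have "\<theta> u y \<in> X closure_of (\<theta> u ` orb (prods ns) p)" by (rule act_closure[OF uG ns(1)])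
    moreover have "\<theta> u ` orb (prods ns) p \<subseteq> orb (prods (n # ns)) p"
      unfolding translate_orb[OF uG prods_carrier p] by (rule orb_mono) (use u(1) in \<open>auto simp: set_mult_def\<close>)
    ultimately show "w \<in> X closure_of (orb (prods (n # ns)) p)"
      unfolding u(2) by (rule in_closure_of_mono)
  qed
  then have "X closure_of (orb (U n) y) \<subseteq> X closure_of (orb (prods (n # ns)) p)"
    by (rule closure_of_minimal) simp
  then have "orbit_gauge p z \<le> weight (n # ns)" by (intro gauge_le subsetD[OF _ z])
  then show "orbit_gauge p z \<le> orbit_gauge p y + (1/2) ^ n + e" using ns(2) by simp
qed

lemma gauge_act:
  assumes "p \<in> topspace X" "y \<in> topspace X" "u \<in> U n"
  shows "\<bar>orbit_gauge p (\<theta> u y) - orbit_gauge p y\<bar> \<le> (1/2) ^ n"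
proof -
  have step: "orbit_gauge p (\<theta> v x) \<le> orbit_gauge p x + (1/2) ^ n" if "x \<in> topspace X" "v \<in> U n" for v x
  proof (rule gauge_closure_orb[OF assms(1) that(1)])
    have "\<theta> v x \<in> orb (U n) x" using that(2) by (auto simp: orb_def)
    then show "\<theta> v x \<in> X closure_of (orb (U n) x)"
      by (rule in_closure_of_self[OF _ orb_subset[OF U_carrier that(1)]])
  qed
  have uG: "u \<in> carrier G" using assms(3) U_carrier by blast
  have "orbit_gauge p y \<le> orbit_gauge p (\<theta> u y) + (1/2) ^ n"
    using step[of "\<theta> u y" "inv u"] act_in[OF uG assms(2)] U_inv[OF assms(3)] act_inv[OF uG assms(2)] by simp
  with step[OF assms(2,3)] show ?thesis by linarith
qed

lemma continuous_map_orbit_gauge: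
  assumes p: "p \<in> topspace X" shows "continuous_map X euclideanreal (orbit_gauge p)"
proof (rule continuous_map_realI)
  fix y and \<epsilon> :: real assume y: "y \<in> topspace X" and "\<epsilon> > 0"
  then obtain n where n: "(1/2) ^ n < \<epsilon>"
    using real_arch_pow_inv[of \<epsilon> "1/2"] by auto
  let ?W = "X interior_of (X closure_of (orb (U (Suc n)) y))"
  have "\<bar>orbit_gauge p z - orbit_gauge p y\<bar> < \<epsilon>" if "z \<in> ?W" for z
  proof -
    have z: "z \<in> X closure_of (orb (U (Suc n)) y)" using that by (rule in_interior_of_imp)
    have zX: "z \<in> topspace X" using z by (simp add: in_closure_of)
    have "orbit_gauge p z \<le> orbit_gauge p y + (1/2) ^ Suc n" by (rule gauge_closure_orb[OF p y z])
    moreover have "(1/2 :: real) ^ Suc n \<le> (1/2) ^ n" by simp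
    moreover have "y \<in> X closure_of (orb (U n) z)"
    proof (rule closure_orb_symmetric[OF U_nbhd _ y z])
      fix a b assume ab: "a \<in> U (Suc n)" "b \<in> U (Suc n)"
      then have "inv a \<otimes> b \<otimes> \<one> \<in> U n" by (intro U_cube U_inv one_in_U)
      moreover have "a \<in> carrier G" "b \<in> carrier G" using ab U_carrier by blast+
      ultimately show "inv a \<otimes> b \<in> U n" by simp
    qed
    then have "orbit_gauge p y \<le> orbit_gauge p z + (1/2) ^ n" by (rule gauge_closure_orb[OF p zX])
    ultimately show ?thesis using n by linarith
  qed
  then show "\<exists>W. openin X W \<and> y \<in> W \<and> (\<forall>z\<in>W. \<bar>orbit_gauge p z - orbit_gauge p y\<bar> < \<epsilon>)"
    using orb_closure[OF U_nbhd y] by (intro exI[of _ ?W]) auto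
qed

text \<open>
  Let \<open>B\<close> be countable with \<open>U n B = G\<close> for all \<open>n\<close>. The functions are the gauges with base points
  \<open>b x\<^sub>0\<close> and their translates by elements \<open>a\<close> of \<open>B\<close>. For a translate by any \<open>g = u a\<close> with
  \<open>u \<in> U n\<close>, the translate by \<open>a\<close> differs from it by at most \<open>2\<^sup>-\<^sup>n\<close>, because gauges change little under small
  group elements. So all translates are uniform limits of members of the family.
\<close>
lemma invariant_family_of_gauges:
  assumes x0: "x0 \<in> topspace X"
  obtains F where "countable F" "invariant_family F"
    "\<And>x. x \<in> topspace X \<Longrightarrow> \<exists>p\<in>topspace X. orbit_gauge p \<in> F \<and> (\<exists>u\<in>U 2. x = \<theta> u p)"
proof -
  have "\<exists>A. countable A \<and> A \<subseteq> carrier G \<and> (\<forall>g\<in>carrier G. \<exists>u\<in>U n. \<exists>a\<in>A. g = u \<otimes> a)" for n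
    using narrow_countable[OF U_nbhd[of n]] by metis
  then obtain A where A: "\<And>n. countable (A n)" "\<And>n. A n \<subseteq> carrier G"
    "\<And>n g. g \<in> carrier G \<Longrightarrow> \<exists>u\<in>U n. \<exists>a\<in>A n. g = u \<otimes> a"
    by metis
  define B where "B = (\<Union>n. A n)"
  have B: "countable B" "B \<subseteq> carrier G" using A by (auto simp: B_def)
  define F where "F = (\<lambda>(a, b). \<lambda>x. orbit_gauge (\<theta> b x0) (\<theta> a x)) ` (B \<times> B) \<union> (\<lambda>b. orbit_gauge (\<theta> b x0)) ` B"
  have px: "\<theta> b x0 \<in> topspace X" if "b \<in> B" for b using that B(2) act_in x0 by blast
  show thesis
  proof
    show "countable F" unfolding F_def using B(1) by simp
    have translate: "continuous_map (initial_topology (topspace X) F) euclideanreal (\<lambda>x. orbit_gauge (\<theta> b x0) (\<theta> g x))"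
      if b: "b \<in> B" and g: "g \<in> carrier G" for b g
    proof (rule continuous_map_real_approx)
      fix \<epsilon> :: real assume "\<epsilon> > 0"
      then obtain n where n: "(1/2) ^ n < \<epsilon>"
        using real_arch_pow_inv[of \<epsilon> "1/2"] by auto
      obtain u a where ua: "u \<in> U n" "a \<in> A n" "g = u \<otimes> a" using A(3)[OF g, of n] by blast
      have "(\<lambda>x. orbit_gauge (\<theta> b x0) (\<theta> a x)) \<in> F"
        unfolding F_def by (rule UnI1, rule image_eqI[of _ _ "(a, b)"]) (use ua(2) b in \<open>auto simp: B_def\<close>)
      then have "continuous_map (initial_topology (topspace X) F) euclideanreal (\<lambda>x. orbit_gauge (\<theta> b x0) (\<theta> a x))"
        by (rule continuous_map_initial_member)
      moreover have "\<bar>orbit_gauge (\<theta> b x0) (\<theta> g x) - orbit_gauge (\<theta> b x0) (\<theta> a x)\<bar> < \<epsilon>" if x: "x \<in> topspace X" for x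
      proof -
        have aG: "a \<in> carrier G" and uG: "u \<in> carrier G" using ua A(2) U_carrier by auto
        have "\<theta> g x = \<theta> u (\<theta> a x)" unfolding ua(3) by (rule act_mult[OF uG aG x])
        then show ?thesis
          using gauge_act[OF px[OF b] act_in[OF aG x] ua(1)] n by simp
      qed
      ultimately show "\<exists>h. continuous_map (initial_topology (topspace X) F) euclideanreal h \<and>
          (\<forall>x\<in>topspace (initial_topology (topspace X) F). \<bar>orbit_gauge (\<theta> b x0) (\<theta> g x) - h x\<bar> < \<epsilon>)"
        by auto
    qed
    show "invariant_family F"
      unfolding invariant_family_def
    proof (intro ballI conjI)
      fix f assume "f \<in> F"
      then consider a b where "a \<in> B" "b \<in> B" "f = (\<lambda>x. orbit_gauge (\<theta> b x0) (\<theta> a x))"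
        | b where "b \<in> B" "f = orbit_gauge (\<theta> b x0)"
        unfolding F_def by auto
      then have "continuous_map X euclideanreal f \<and> (\<forall>g\<in>carrier G.
          continuous_map (initial_topology (topspace X) F) euclideanreal (\<lambda>x. f (\<theta> g x)))"
      proof cases
        case 1
        have aG: "a \<in> carrier G" using 1(1) B(2) by blast
        have "continuous_map X euclideanreal (orbit_gauge (\<theta> b x0) \<circ> \<theta> a)"
          by (rule continuous_map_compose[OF continuous_map_act[OF aG] continuous_map_orbit_gauge[OF px[OF 1(2)]]])
        moreover have "continuous_map (initial_topology (topspace X) F) euclideanreal (\<lambda>x. f (\<theta> g x))"
          if g: "g \<in> carrier G" for g
        proof (rule continuous_map_eq[OF translate[OF 1(2), of "a \<otimes> g"]])
          show "a \<otimes> g \<in> carrier G" using aG g by simp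
          show "orbit_gauge (\<theta> b x0) (\<theta> (a \<otimes> g) x) = f (\<theta> g x)" if "x \<in> topspace (initial_topology (topspace X) F)" for x
            using that 1(3) act_mult[OF aG g] by simp
        qed
        ultimately show ?thesis by (simp add: 1(3) o_def)
      next
        case 2
        then show ?thesis using continuous_map_orbit_gauge[OF px] translate by simp
      qed
      then show "continuous_map X euclideanreal f"
        "g \<in> carrier G \<Longrightarrow> continuous_map (initial_topology (topspace X) F) euclideanreal (\<lambda>x. f (\<theta> g x))" for g
        by auto
    qed
    fix x assume x: "x \<in> topspace X"
    then obtain g where g: "g \<in> carrier G" "\<theta> g x0 = x" using unique_orbit[OF x0 x] by blast
    obtain u b where ub: "u \<in> U 2" "b \<in> A 2" "g = u \<otimes> b" using A(3)[OF g(1), of 2] by blast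
    have bB: "b \<in> B" using ub(2) by (auto simp: B_def)
    have "x = \<theta> u (\<theta> b x0)"
      using g(2) ub(3) act_mult[of u b x0] ub(1) U_carrier bB B(2) x0 by auto
    moreover have "orbit_gauge (\<theta> b x0) \<in> F" unfolding F_def using bB by blast
    ultimately show "\<exists>p\<in>topspace X. orbit_gauge p \<in> F \<and> (\<exists>u\<in>U 2. x = \<theta> u p)"
      using px[OF bB] ub(1) by blast
  qed
qed

end

context dense_orbit_action
begin

text \<open>
  Choose a base point \<open>p\<close> with \<open>x = u p\<close> and \<open>u \<in> U 2\<close>. Then the gauge of \<open>x\<close> is at most \<open>1/4\<close>, and every
  \<open>y\<close> of gauge below \<open>1/2\<close> is in the closure of \<open>U 1 p = U 1 u\<^sup>-\<^sup>1 x\<close>, which is inside \<open>N x\<close> before taking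
  closures.
\<close>
lemma countable_invariant_family:
  assumes "nbhd N"
  obtains F where "countable F" "invariant_family F"
    "\<And>x. x \<in> topspace X \<Longrightarrow> \<exists>W. openin (initial_topology (topspace X) F) W \<and> x \<in> W \<and> W \<subseteq> X closure_of (orb N x)"
proof (cases "topspace X = {}")
  case True
  have "invariant_family {}" by (simp add: invariant_family_def)
  then show thesis using that[of "{}"] True by blast
next
  case False
  then obtain x0 where x0: "x0 \<in> topspace X" by blast
  define P where "P V \<longleftrightarrow> nbhd V \<and> (\<forall>v\<in>V. inv v \<in> V)" for V
  define Q where "Q U V \<longleftrightarrow> (\<forall>a\<in>V. \<forall>b\<in>V. \<forall>c\<in>V. a \<otimes> b \<otimes> c \<in> U)" for U V
  have half: "\<exists>V. P V \<and> Q U V" if "nbhd U" for U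
    using nbhd_symmetric_cube[OF that] unfolding P_def Q_def by metis
  obtain V0 where V0: "P V0" "Q N V0" using half[OF assms] by blast
  \<comment> \<open>The sequence starts with \<open>V0\<close>, whose cube is in \<open>N\<close>, and is then shifted by one to make room for the
    whole group at index 0.\<close>
  define V where "V = rec_nat V0 (\<lambda>_ U. SOME V. P V \<and> Q U V)"
  have V_simps: "V 0 = V0" "\<And>n. V (Suc n) = (SOME W. P W \<and> Q (V n) W)"
    by (simp_all add: V_def)
  have V: "P (V n)" "Q (V n) (V (Suc n))" for n
  proof -
    have step: "P (V (Suc n)) \<and> Q (V n) (V (Suc n))" if "P (V n)" for n
    proof -
      have "nbhd (V n)" using that by (simp add: P_def)
      then have "\<exists>W. P W \<and> Q (V n) W" by (rule half)
      then show ?thesis unfolding V_simps(2) by (rule someI_ex)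
    qed
    have P: "P (V n)" for n
    proof (induction n)
      case 0
      show ?case using V0(1) V_simps(1) by simp
    next
      case (Suc n)
      then show ?case using step[of n] by simp
    qed
    then show "P (V n)" .
    show "Q (V n) (V (Suc n))" using step[OF P] by simp
  qed
  define U where "U n = (case n of 0 \<Rightarrow> carrier G | Suc m \<Rightarrow> V m)" for n
  interpret gauge_sequence G T X \<theta> U
  proof
    show "U 0 = carrier G" by (simp add: U_def)
    show "nbhd (U n)" for n
      using V(1) openin_topspace[of T] by (auto simp: U_def P_def nbhd_def topspace_T split: nat.split)
    show "inv v \<in> U n" if "v \<in> U n" for v n
      using that V(1) by (auto simp: U_def P_def split: nat.splits)
    show "a \<otimes> b \<otimes> c \<in> U n" if "a \<in> U (Suc n)" "b \<in> U (Suc n)" "c \<in> U (Suc n)" for a b c n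
    proof (cases n)
      case 0
      have "nbhd (V 0)" using V(1) by (simp add: P_def)
      then show ?thesis using that 0 nbhd_carrier by (auto simp: U_def)
    next
      case (Suc m)
      then show ?thesis using that V(2)[of m] by (auto simp: U_def Q_def)
    qed
  qed
  obtain F where F: "countable F" "invariant_family F"
    "\<And>x. x \<in> topspace X \<Longrightarrow> \<exists>p\<in>topspace X. orbit_gauge p \<in> F \<and> (\<exists>u\<in>U 2. x = \<theta> u p)"
    using invariant_family_of_gauges[OF x0] by metis
  show thesis
  proof (rule that[OF F(1,2)])
    fix x assume x: "x \<in> topspace X"
    obtain p u where p: "p \<in> topspace X" "orbit_gauge p \<in> F" and u: "u \<in> U 2" "x = \<theta> u p"
      using F(3)[OF x] by blast
    have uG: "u \<in> carrier G" using u(1) U_carrier by blast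
    let ?W = "{y \<in> topspace (initial_topology (topspace X) F). orbit_gauge p y \<in> {..<1/2}}"
    have "openin (initial_topology (topspace X) F) ?W"
      by (rule openin_continuous_map_preimage[OF continuous_map_initial_member[OF p(2)]]) simp
    moreover have "x \<in> ?W"
    proof -
      have "x \<in> orb (prods [2]) p"
      proof -
        have "u \<otimes> \<one> \<in> prods [2]" using u(1) by (auto simp: set_mult_def)
        then show ?thesis using u(2) uG by (auto simp: orb_def)
      qed
      then have "x \<in> X closure_of (orb (prods [2]) p)"
        by (rule in_closure_of_self[OF _ orb_subset[OF prods_carrier p(1)]])
      then have "orbit_gauge p x \<le> weight [2]" by (rule gauge_le)
      then show ?thesis using x by (simp add: power2_eq_square)
    qed
    moreover have "?W \<subseteq> X closure_of (orb N x)"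
    proof
      fix y assume "y \<in> ?W"
      then have "y \<in> X closure_of (orb (U 1) p)"
        by (intro gauge_less_power p(1)) auto
      moreover have "orb (U 1) p \<subseteq> orb N x"
      proof
        fix w assume "w \<in> orb (U 1) p"
        then obtain v where v: "v \<in> U 1" "w = \<theta> v p" by (auto simp: orb_def)
        have vG: "v \<in> carrier G" using v(1) U_carrier by blast
        have "inv u \<in> U 1" using U_inv[OF u(1)] U_antimono[of 1 2] by auto
        then have "v \<otimes> inv u \<otimes> \<one> \<in> N"
          using V0(2) v(1) one_in_U[of 1] unfolding Q_def U_def by (simp add: V_simps(1))
        moreover have "w = \<theta> (v \<otimes> inv u \<otimes> \<one>) x"
          using v(2) u(2) uG vG p(1) x by (simp add: act_mult act_inv)
        ultimately show "w \<in> orb N x" by (auto simp: orb_def)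
      qed
      ultimately show "y \<in> X closure_of (orb N x)" by (rule in_closure_of_mono)
    qed
    ultimately show "\<exists>W. openin (initial_topology (topspace X) F) W \<and> x \<in> W \<and> W \<subseteq> X closure_of (orb N x)"
      by blast
  qed
qed

end

section \<open>Fine covers over compact sets and the Dugundji property\<close>

context narrow_action
begin

text \<open>
  By regularity and continuity of the action, each point of \<open>K\<close> has a neighbourhood \<open>P\<close> and a \<open>U\<close> such
  that the closures of \<open>U y\<close> for \<open>y \<in> P\<close> are in one member of the cover. Finitely many such \<open>P\<close> cover
  \<open>K\<close>; intersect the corresponding \<open>U\<close>.
\<close>
lemma orbit_closures_refine_on_compact:
  assumes K: "compactin X K" and cover: "K \<subseteq> \<Union>\<C>" "\<And>C. C \<in> \<C> \<Longrightarrow> openin X C"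
  obtains U where "nbhd U" "\<And>x. x \<in> K \<Longrightarrow> \<exists>C\<in>\<C>. X closure_of (orb U x) \<subseteq> C"
proof -
  have "\<exists>U P. nbhd U \<and> openin X P \<and> x \<in> P \<and> (\<exists>C\<in>\<C>. \<forall>V\<subseteq>U. \<forall>y\<in>P. X closure_of (orb V y) \<subseteq> C)"
    if x: "x \<in> K" for x
  proof -
    obtain C where C: "C \<in> \<C>" "x \<in> C" using cover(1) x by blast
    obtain W where W: "openin X W" "x \<in> W" "X closure_of W \<subseteq> C"
      using regular_space_shrink[OF regular cover(2)[OF C(1)] C(2)] by metis
    obtain U P where UP: "nbhd U" "openin X P" "x \<in> P" "\<And>u y. u \<in> U \<Longrightarrow> y \<in> P \<Longrightarrow> \<theta> u y \<in> W"
      using act_nbhd[OF W(1,2)] by metis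
    have "X closure_of (orb V y) \<subseteq> C" if "V \<subseteq> U" "y \<in> P" for V y
    proof -
      have "orb V y \<subseteq> W" using that UP(4) by (auto simp: orb_def)
      then have "X closure_of (orb V y) \<subseteq> X closure_of W" by (rule closure_of_mono)
      then show ?thesis using W(3) by simp
    qed
    then have "\<exists>C\<in>\<C>. \<forall>V\<subseteq>U. \<forall>y\<in>P. X closure_of (orb V y) \<subseteq> C"
      by (intro bexI[OF _ C(1)] allI impI ballI)
    then show ?thesis using UP(1-3) by (intro exI[of _ U] exI[of _ P] conjI)
  qed
  then obtain U P where UP: "\<And>x. x \<in> K \<Longrightarrow> nbhd (U x)" "\<And>x. x \<in> K \<Longrightarrow> openin X (P x)" "\<And>x. x \<in> K \<Longrightarrow> x \<in> P x"
    "\<And>x. x \<in> K \<Longrightarrow> \<exists>C\<in>\<C>. \<forall>V\<subseteq>U x. \<forall>y\<in>P x. X closure_of (orb V y) \<subseteq> C"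
    by metis
  have "\<exists>\<P>. finite \<P> \<and> \<P> \<subseteq> P ` K \<and> K \<subseteq> \<Union>\<P>"
    by (rule compactinD[OF K]) (use UP(2,3) in auto)
  then obtain K' where K': "finite K'" "K' \<subseteq> K" "K \<subseteq> (\<Union>x\<in>K'. P x)"
    by (metis finite_subset_image)
  define N where "N = (\<Inter>x\<in>K'. U x) \<inter> topspace T"
  have "openin T N"
    unfolding N_def by (rule openin_INT[OF K'(1)]) (use UP(1) K'(2) in \<open>auto simp: nbhd_def\<close>)
  then have "nbhd N"
    using UP(1) K'(2) by (auto simp: nbhd_def N_def topspace_T)
  moreover have "\<exists>C\<in>\<C>. X closure_of (orb N y) \<subseteq> C" if y: "y \<in> K" for y
  proof -
    obtain x where x: "x \<in> K'" "y \<in> P x" using K'(3) y by blast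
    have "N \<subseteq> U x" using x(1) by (auto simp: N_def)
    moreover have "x \<in> K" using x(1) K'(2) by blast
    from UP(4)[OF this] obtain C where "C \<in> \<C>" "\<forall>V\<subseteq>U x. \<forall>y\<in>P x. X closure_of (orb V y) \<subseteq> C"
      by (rule bexE)
    ultimately show ?thesis using x(2) by (intro bexI[of _ C]) auto
  qed
  ultimately show thesis by (rule that)
qed

text \<open>
  Fine neighbourhoods at the points of \<open>S\<close> make the initial topology non-meager, and invariance lets
  the group act on it by homeomorphisms.
\<close>
lemma dense_orbits_of_complete_covers:
  assumes cc: "complete_covers X D \<C>"
    and S: "S \<subseteq> D" "\<And>W. openin X W \<Longrightarrow> W \<noteq> {} \<Longrightarrow> W \<inter> S \<noteq> {}"
    and F: "invariant_family F"
    and small: "\<And>n x. x \<in> S \<Longrightarrow>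
      \<exists>W. openin (initial_topology (topspace X) F) W \<and> x \<in> W \<and> (\<exists>C\<in>\<C> n. W \<subseteq> C)"
    and U: "nbhd U" and x: "x \<in> topspace X"
  shows "x \<in> initial_topology (topspace X) F interior_of
    (initial_topology (topspace X) F closure_of (orb U x))"
proof (rule orb_closure_nbhd[OF topspace_initial invariant_family_continuous_map_act[OF F] _ U x])
  let ?t = "initial_topology (topspace X) F"
  fix \<A> :: "'a set set" assume \<A>: "countable \<A>" "topspace ?t \<subseteq> \<Union>\<A>"
  have coarser: "openin X W" if "openin ?t W" for W
    by (rule openin_initial_imp[OF that]) (use F in \<open>simp add: invariant_family_def\<close>)
  have ne: "topspace ?t \<noteq> {}" using x by auto
  show "\<exists>A\<in>\<A>. ?t interior_of (?t closure_of A) \<noteq> {}"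
    by (rule nonmeager_coarser_topology[OF cc coarser topspace_initial regular_space_initial S small \<A> ne])
qed

lemma dense_orbit_action_of_complete_covers:
  assumes cc: "complete_covers X D \<C>"
    and S: "S \<subseteq> D" "\<And>W. openin X W \<Longrightarrow> W \<noteq> {} \<Longrightarrow> W \<inter> S \<noteq> {}"
  shows "dense_orbit_action G T X \<theta>"
proof
  fix U x assume U: "nbhd U" and x: "x \<in> topspace X"
  show "x \<in> X interior_of (X closure_of (orb U x))"
  proof (rule orb_closure_nbhd[OF refl continuous_map_act _ U x])
    fix \<A> :: "'a set set" assume \<A>: "countable \<A>" "topspace X \<subseteq> \<Union>\<A>"
    have small: "\<exists>W. openin X W \<and> x \<in> W \<and> (\<exists>U\<in>\<C> n. W \<subseteq> U)" if "x \<in> S" for n x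
    proof -
      have "x \<in> \<Union>(\<C> n)" using that S(1) complete_covers_cover[OF cc] by blast
      then obtain C where C: "C \<in> \<C> n" "x \<in> C" by auto
      show ?thesis
        by (rule exI[of _ C]) (use C complete_covers_open[OF cc C(1)] in auto)
    qed
    have "topspace X \<noteq> {}" using x by auto
    show "\<exists>A\<in>\<A>. X interior_of (X closure_of A) \<noteq> {}"
      by (rule nonmeager_coarser_topology[OF cc _ refl regular S small \<A> \<open>topspace X \<noteq> {}\<close>])
  qed
qed

end

context dense_orbit_action
begin

lemma invariant_family_refines_on_compact:
  assumes K: "compactin X K" and cover: "K \<subseteq> \<Union>\<C>" "\<And>C. C \<in> \<C> \<Longrightarrow> openin X C"
  shows "\<exists>F. countable F \<and> invariant_family F \<and>
    (\<forall>x\<in>K. \<exists>W. openin (initial_topology (topspace X) F) W \<and> x \<in> W \<and> (\<exists>C\<in>\<C>. W \<subseteq> C))"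
proof -
  obtain U where U: "nbhd U" "\<And>x. x \<in> K \<Longrightarrow> \<exists>C\<in>\<C>. X closure_of (orb U x) \<subseteq> C"
    by (rule orbit_closures_refine_on_compact[OF K cover]) (assumption, rule that)
  obtain F where F: "countable F" "invariant_family F" "\<And>x. x \<in> topspace X \<Longrightarrow>
      \<exists>W. openin (initial_topology (topspace X) F) W \<and> x \<in> W \<and> W \<subseteq> X closure_of (orb U x)"
    using countable_invariant_family[OF U(1)] by metis
  have "\<exists>W. openin (initial_topology (topspace X) F) W \<and> x \<in> W \<and> (\<exists>C\<in>\<C>. W \<subseteq> C)" if x: "x \<in> K" for x
  proof -
    have "x \<in> topspace X" using compactin_subset_topspace[OF K] x by blast
    then obtain W where W: "openin (initial_topology (topspace X) F) W" "x \<in> W" "W \<subseteq> X closure_of (orb U x)"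
      using F(3) by auto
    obtain C where "C \<in> \<C>" "X closure_of (orb U x) \<subseteq> C" using U(2)[OF x] by auto
    then show ?thesis using W by (metis subset_trans)
  qed
  then show ?thesis using F(1,2) by blast
qed

lemma invariant_family_separates:
  assumes W: "openin X W" "x \<in> W"
  shows "\<exists>F. countable F \<and> invariant_family F \<and>
    (\<exists>V. openin (initial_topology (topspace X) F) V \<and> x \<in> V \<and> V \<subseteq> W)"
proof -
  have "compactin X {x}" using openin_subset[OF W(1)] W(2) by auto
  from invariant_family_refines_on_compact[OF this, of "{W}"] show ?thesis using W by auto
qed

lemma invariant_family_for_covers:
  assumes cc: "complete_covers X D \<C>"
    and \<K>: "countable \<K>" "\<forall>K\<in>\<K>. compactin X K" "\<Union>\<K> \<subseteq> D"
  shows "\<exists>B. countable B \<and> invariant_family B \<and> (\<forall>F n x. B \<subseteq> F \<longrightarrow> x \<in> \<Union>\<K> \<longrightarrow>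
    (\<exists>W. openin (initial_topology (topspace X) F) W \<and> x \<in> W \<and> (\<exists>C\<in>\<C> n. W \<subseteq> C)))"
proof -
  have "\<exists>F. countable F \<and> invariant_family F \<and>
      (\<forall>x\<in>K. \<exists>W. openin (initial_topology (topspace X) F) W \<and> x \<in> W \<and> (\<exists>C\<in>\<C> n. W \<subseteq> C))"
    if K: "K \<in> \<K>" for K n
  proof (rule invariant_family_refines_on_compact)
    show "compactin X K" using \<K>(2) K by blast
    show "K \<subseteq> \<Union>(\<C> n)" using K \<K>(3) complete_covers_cover[OF cc, of n] by blast
  qed (rule complete_covers_open[OF cc])
  then obtain H where H: "\<And>K n. K \<in> \<K> \<Longrightarrow> countable (H K n)" "\<And>K n. K \<in> \<K> \<Longrightarrow> invariant_family (H K n)"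
    "\<And>K n x. K \<in> \<K> \<Longrightarrow> x \<in> K \<Longrightarrow>
      \<exists>W. openin (initial_topology (topspace X) (H K n)) W \<and> x \<in> W \<and> (\<exists>C\<in>\<C> n. W \<subseteq> C)"
    by metis
  define B where "B = (\<Union>K\<in>\<K>. \<Union>n. H K n)"
  show ?thesis
  proof (intro exI[of _ B] conjI allI impI)
    show "countable B" unfolding B_def by (intro countable_UN \<K>(1) H(1) countableI_type)
    have "B = \<Union>((\<lambda>(K, n). H K n) ` (\<K> \<times> UNIV))" by (auto simp: B_def)
    then show "invariant_family B" using invariant_family_Union[of "(\<lambda>(K, n). H K n) ` (\<K> \<times> UNIV)"] H(2) by auto
    fix F n x assume F: "B \<subseteq> F" and x: "x \<in> \<Union>\<K>"
    obtain K where K: "K \<in> \<K>" "x \<in> K" using x by blast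
    obtain W where W: "openin (initial_topology (topspace X) (H K n)) W" "x \<in> W" "\<exists>C\<in>\<C> n. W \<subseteq> C"
      using H(3)[OF K] by metis
    have "H K n \<subseteq> F" using F K(1) by (auto simp: B_def)
    from openin_initial_mono[OF W(1) this] W(2,3)
    show "\<exists>W. openin (initial_topology (topspace X) F) W \<and> x \<in> W \<and> (\<exists>C\<in>\<C> n. W \<subseteq> C)" by auto
  qed
qed

end

context narrow_action
begin

text \<open>
  Every nonempty open \<open>V\<close> contains some \<open>U x\<close>, whose closure in the coarser topology is a
  neighbourhood of \<open>x\<close>.
\<close>
theorem skeletally_Dugundji_if_dense_Cech_complete:
  assumes D: "dense_subset X D" "Cech_complete_space (subtopology X D)" "k_separable_space (subtopology X D)"
  shows "skeletally_Dugundji X"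
proof -
  have DX: "D \<subseteq> topspace X" "X closure_of D = topspace X" using D(1) by (auto simp: dense_subset_def)
  obtain \<C> where cc: "complete_covers X D \<C>"
    using Cech_complete_imp_complete_covers[OF D(2) DX(1)] .
  obtain S where S: "dense_subset (subtopology X D) S" "sigma_compact_in (subtopology X D) S"
    using D(3) by (auto simp: k_separable_space_def)
  then obtain \<K> where \<K>: "countable \<K>" "\<forall>K\<in>\<K>. compactin (subtopology X D) K" "S = \<Union>\<K>"
    by (auto simp: sigma_compact_in_def)
  have SD: "S \<subseteq> D" using S(1) DX(1) by (auto simp: dense_subset_def)
  have dense: "W \<inter> S \<noteq> {}" if W: "openin X W" "W \<noteq> {}" for W
  proof -
    have "W \<inter> D \<noteq> {}"
      using W DX(2) openin_subset[OF W(1)] dense_intersects_open[of X D] by auto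
    then obtain d where d: "d \<in> W" "d \<in> D" by blast
    have "d \<in> subtopology X D closure_of S"
      using S(1) d(2) DX(1) by (auto simp: dense_subset_def)
    then have near: "\<forall>V. d \<in> V \<and> openin (subtopology X D) V \<longrightarrow> (\<exists>s. s \<in> S \<and> s \<in> V)"
      unfolding in_closure_of[of d] by (rule conjunct2)
    have "openin (subtopology X D) (W \<inter> D)" using W(1) by (auto simp: openin_subtopology)
    with d have "d \<in> W \<inter> D \<and> openin (subtopology X D) (W \<inter> D)" by simp
    then have "\<exists>s. s \<in> S \<and> s \<in> W \<inter> D" by (rule near[THEN spec, THEN mp])
    then show ?thesis by blast
  qed
  interpret dense_orbit_action G T X \<theta>
    by (rule dense_orbit_action_of_complete_covers[OF cc SD dense])
  have compact: "\<forall>K\<in>\<K>. compactin X K" using \<K>(2) by (simp add: compactin_subtopology)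
  obtain B where B: "countable B" "invariant_family B" and small: "\<forall>F n x. B \<subseteq> F \<longrightarrow> x \<in> \<Union>\<K> \<longrightarrow>
      (\<exists>W. openin (initial_topology (topspace X) F) W \<and> x \<in> W \<and> (\<exists>C\<in>\<C> n. W \<subseteq> C))"
    using invariant_family_for_covers[OF cc \<K>(1) compact SD[unfolded \<K>(3)]]
    by (elim exE conjE) (rule that)
  have cont: "continuous_map X euclideanreal f" if "invariant_family F" "f \<in> F" for F f
    using that by (simp add: invariant_family_def)
  show ?thesis
    unfolding skeletally_Dugundji_def
  proof (rule Dugundji_space_by_functions[where good = invariant_family, OF Tych cont invariant_family_Union B invariant_family_separates])
    fix F F' assume F: "invariant_family F" "invariant_family F'" "B \<subseteq> F" "F \<subseteq> F'"
    show "skeletal_map (function_quotient (topspace X) F') (function_quotient (topspace X) F)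
        (representative (topspace X) F)"
    proof (rule skeletal_map_representative[OF cont[OF F(2)] F(4)])
      let ?t = "initial_topology (topspace X) F"
      fix V assume V: "openin X V" "V \<noteq> {}"
      then obtain x where x: "x \<in> V" by blast
      obtain U P where U: "nbhd U" "x \<in> P" "\<And>u y. u \<in> U \<Longrightarrow> y \<in> P \<Longrightarrow> \<theta> u y \<in> V"
        using act_nbhd[OF V(1) x] by metis
      have "orb U x \<subseteq> V" using U(2,3) by (auto simp: orb_def)
      then have "?t interior_of (?t closure_of (orb U x)) \<subseteq> ?t interior_of (?t closure_of V)"
        by (intro interior_of_mono closure_of_mono)
      moreover have "x \<in> ?t interior_of (?t closure_of (orb U x))"
      proof (rule dense_orbits_of_complete_covers[OF cc SD dense F(1) _ U(1)])
        show "x \<in> topspace X" using openin_subset[OF V(1)] x by blast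
      qed (use small F(3) \<K>(3) in simp_all)
      ultimately show "?t interior_of (?t closure_of V) \<noteq> {}" by blast
    qed
  qed auto
qed

text \<open>
  Given \<open>x \<in> V\<close>, choose \<open>U x\<close> inside an open set whose closure \<open>A\<close> in \<open>X\<close> is contained in \<open>V\<close>. The closure of \<open>U x\<close>
  in the coarser topology is a neighbourhood of \<open>x\<close> there and lies in the saturation of \<open>A\<close>, hence in that of \<open>V\<close>.
\<close>
theorem openly_Dugundji_if_Cech_complete:
  assumes "Cech_complete_space X" "sigma_compact_in X (topspace X)"
  shows "openly_Dugundji X"
proof -
  have "Cech_complete_space (subtopology X (topspace X))" using assms(1) by simp
  then obtain \<C> where cc: "complete_covers X (topspace X) \<C>"
    using Cech_complete_imp_complete_covers[of X "topspace X"] by blast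
  obtain \<K> where \<K>: "countable \<K>" "\<forall>K\<in>\<K>. compactin X K" "topspace X = \<Union>\<K>"
    using assms(2) by (auto simp: sigma_compact_in_def)
  have dense: "W \<inter> topspace X \<noteq> {}" if "openin X W" "W \<noteq> {}" for W
    using that openin_subset[of X W] by blast
  interpret dense_orbit_action G T X \<theta>
    by (rule dense_orbit_action_of_complete_covers[OF cc subset_refl dense])
  obtain B where B: "countable B" "invariant_family B" and B_small: "\<forall>F n x. B \<subseteq> F \<longrightarrow> x \<in> \<Union>\<K> \<longrightarrow>
      (\<exists>W. openin (initial_topology (topspace X) F) W \<and> x \<in> W \<and> (\<exists>C\<in>\<C> n. W \<subseteq> C))"
    using invariant_family_for_covers[OF cc \<K>(1,2) equalityD2[OF \<K>(3)]]
    by (elim exE conjE) (rule that)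
  have cont: "continuous_map X euclideanreal f" if "invariant_family F" "f \<in> F" for F f
    using that by (simp add: invariant_family_def)
  show ?thesis
    unfolding openly_Dugundji_def
  proof (rule Dugundji_space_by_functions[where good = invariant_family, OF Tych cont invariant_family_Union B invariant_family_separates])
    fix F F' assume F: "invariant_family F" "invariant_family F'" "B \<subseteq> F" "F \<subseteq> F'"
    show "continuous_open_map (function_quotient (topspace X) F') (function_quotient (topspace X) F)
        (representative (topspace X) F)"
    proof (rule open_map_representative[OF cont[OF F(2)] F(4)])
      let ?t = "initial_topology (topspace X) F"
      fix V x assume V: "openin X V" "x \<in> V"
      obtain V' where V': "openin X V'" "x \<in> V'" "X closure_of V' \<subseteq> V"
        using regular_space_shrink[OF regular V] by metis
      obtain U P where U: "nbhd U" "x \<in> P" "\<And>u y. u \<in> U \<Longrightarrow> y \<in> P \<Longrightarrow> \<theta> u y \<in> V'"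
        using act_nbhd[OF V'(1,2)] by metis
      have sub: "orb U x \<subseteq> X closure_of V'"
        using U(2,3) closure_of_subset[OF openin_subset[OF V'(1)]] by (auto simp: orb_def)
      define W where "W = ?t interior_of (?t closure_of (orb U x))"
      have W: "openin ?t W" by (simp add: W_def)
      have small: "\<exists>W. openin ?t W \<and> w \<in> W \<and> (\<exists>C\<in>\<C> n. W \<subseteq> C)" if "w \<in> topspace X" for n w
        using B_small F(3) that unfolding \<K>(3) by simp
      have coarser: "openin X S" if "openin ?t S" for S
        by (rule openin_initial_imp[OF that]) (use F(1) in \<open>simp add: invariant_family_def\<close>)
      have "\<exists>v\<in>V. \<forall>f\<in>F. f v = f w" if w: "w \<in> W" for w
      proof -
        have wE: "w \<in> topspace X" using openin_subset[OF W] w by auto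
        have "w \<in> ?t closure_of (orb U x)" using w unfolding W_def by (rule in_interior_of_imp)
        then have "w \<in> ?t closure_of (X closure_of V')" by (rule in_closure_of_mono[OF _ sub])
        then obtain z where z: "z \<in> X closure_of V'" "\<And>S. openin ?t S \<Longrightarrow> w \<in> S \<Longrightarrow> z \<in> S"
          using closure_of_coarser_saturation[OF cc coarser topspace_initial regular_space_initial small[OF wE]
              closedin_closure_of] by metis
        have "f z = f w" if f: "f \<in> F" for f
        proof (rule ccontr)
          assume neq: "f z \<noteq> f w"
          have "z \<in> {y \<in> topspace ?t. f y \<in> - {f z}}"
            by (rule z(2)[OF openin_continuous_map_preimage[OF continuous_map_initial_member[OF f]]])
               (use wE neq in auto)
          then show False by simp
        qed
        then show ?thesis using z(1) V'(3) by blast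
      qed
      moreover have "x \<in> W"
        unfolding W_def
      proof (rule dense_orbits_of_complete_covers[OF cc subset_refl dense F(1) small U(1)])
        show "x \<in> topspace X" using openin_subset[OF V(1)] V(2) by blast
      qed
      ultimately show "\<exists>W. openin ?t W \<and> x \<in> W \<and> (\<forall>w\<in>W. \<exists>v\<in>V. \<forall>f\<in>F. f v = f w)"
        using W by (intro exI[of _ W]) simp
    qed
  qed auto
qed

end

theorem corollary1p2:
  fixes G :: "('g, 'm) monoid_scheme" and T :: "'g topology"
    and X :: "'a topology" and \<theta> :: "'g \<Rightarrow> 'a \<Rightarrow> 'a"
  assumes "topological_group G T" and "Tychonoff_space T" and "omega_narrow G T"
    and "Tychonoff_space X"
    and "transitive_action G (topspace X) \<theta>"
    and "continuous_map (prod_topology T X) X (\<lambda>(g, x). \<theta> g x)"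
  shows "((\<exists>D. dense_subset X D \<and> Cech_complete_space (subtopology X D) \<and>
               k_separable_space (subtopology X D)) \<longrightarrow> skeletally_Dugundji X) \<and>
         (Cech_complete_space X \<and> sigma_compact_in X (topspace X) \<longrightarrow> openly_Dugundji X)"
proof -
  interpret narrow_action G T X \<theta>
    by (rule narrow_action.intro) (fact assms)+
  show ?thesis
    using skeletally_Dugundji_if_dense_Cech_complete openly_Dugundji_if_Cech_complete by blast
qed

end
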